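(* Let $(X,\tau)$ be a locally convex space whose topology $\tau$ is determined by a family $\mathcal{N}$ of seminorms on $X$, and let $Q\subset X$ be a nonempty weakly compact convex subset. Let $(S,Q)$ be a dynamical system, where $Q$ carries the weak topology, which is $\mathcal{N}$-nonexpansive and $\tau$-distal. Then there is a fixed point of $S$ in $Q$, i.e. a point $x\in Q$ with $sx=x$ for every $s\in S$. Moreover, the set $F(S)=\{x\in Q: sx=x\text{ for every }s\in S\}$ is an $\mathcal{N}$-nonexpansive retract of $Q$.
   Context: Locally convex spaces are Hausdorff. A dynamical system $(S,Q)$ consists of a semigroup $S$, a topological space $Q$ and a semigroup action $S\times Q\to Q$, $(s,x)\mapsto sx$ (so $(st)x=s(tx)$), such that for each $s\in S$ the map $Q\ni x\mapsto sx\in Q$ is continuous in the topology of $Q$. Here the topology on $Q$ is the weak topology inherited from $X$. $(S,Q)$ is $\mathcal{N}$-nonexpansive if $p(sx-sy)\le p(x-y)$ for every $p\in\mathcal{N}$, $s\in S$ and $x,y\in Q$. It is $\tau$-distal if for every pair of distinct points $x,y\in Q$, $0$ does not belong to the $\tau$-closure of $\{sx-sy:s\in S\}$. $F(S)$ is an $\mathcal{N}$-nonexpansive retract of $Q$ if there is a map $r$ of $Q$ onto $F(S)$ with $r\circ r=r$ (equivalently, $r(Q)\subset F(S)$ and $r(x)=x$ for $x\in F(S)$) such that $p(r(x)-r(y))\le p(x-y)$ for all $p\in\mathcal{N}$ and $x,y\in Q$; weak continuity of $r$ is not required. *)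

theory Defs
  imports "HOL-Analysis.Analysis"
begin

definition seminorm :: "('a::real_vector \<Rightarrow> real) \<Rightarrow> bool" where
  "seminorm p \<longleftrightarrow>
     (\<forall>x. 0 \<le> p x) \<and>
     (\<forall>x y. p (x + y) \<le> p x + p y) \<and>
     (\<forall>c x. p (c *\<^sub>R x) = \<bar>c\<bar> * p x)"

text \<open>The set \<open>UNIV\<close> is among the generators only so that the carrier of the
  topology is the whole space even when the family of seminorms is empty.
  The family need not be directed, since finite intersections of generators are open.\<close>

definition seminorm_topology :: "('a::real_vector \<Rightarrow> real) set \<Rightarrow> 'a topology" where
  "seminorm_topology \<N> =
     topology_generated_by (insert UNIV {{x. p (x - a) < e} | p a e. p \<in> \<N> \<and> 0 < e})"

definition weak_topology :: "'a::real_vector topology \<Rightarrow> 'a topology" where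
  "weak_topology \<tau> =
     topology_generated_by
       {f -` U | (f :: 'a \<Rightarrow> real) U. linear f \<and> continuous_map \<tau> euclideanreal f \<and> open U}"

text \<open>The phase space is \<open>topspace T\<close>; the values of the action outside of it are irrelevant.
  Invariance of the phase space is part of \<^const>\<open>continuous_map\<close>.\<close>

definition dynamical_system :: "('s::semigroup_mult \<Rightarrow> 'a \<Rightarrow> 'a) \<Rightarrow> 'a topology \<Rightarrow> bool" where
  "dynamical_system act T \<longleftrightarrow>
     (\<forall>s. continuous_map T T (act s)) \<and>
     (\<forall>s t. \<forall>x\<in>topspace T. act (s * t) x = act s (act t x))"

definition nonexpansive_map_on :: "('a::real_vector \<Rightarrow> real) set \<Rightarrow> 'a set \<Rightarrow> ('a \<Rightarrow> 'a) \<Rightarrow> bool" where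
  "nonexpansive_map_on \<N> Q f \<longleftrightarrow> (\<forall>p\<in>\<N>. \<forall>x\<in>Q. \<forall>y\<in>Q. p (f x - f y) \<le> p (x - y))"

definition nonexpansive_action ::
    "('a::real_vector \<Rightarrow> real) set \<Rightarrow> ('s \<Rightarrow> 'a \<Rightarrow> 'a) \<Rightarrow> 'a set \<Rightarrow> bool" where
  "nonexpansive_action \<N> act Q \<longleftrightarrow> (\<forall>s. nonexpansive_map_on \<N> Q (act s))"

definition distal_action ::
    "'a::real_vector topology \<Rightarrow> ('s \<Rightarrow> 'a \<Rightarrow> 'a) \<Rightarrow> 'a set \<Rightarrow> bool" where
  "distal_action \<tau> act Q \<longleftrightarrow>
     (\<forall>x\<in>Q. \<forall>y\<in>Q. x \<noteq> y \<longrightarrow> 0 \<notin> \<tau> closure_of {act s x - act s y | s. True})"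

definition fixed_points :: "('s \<Rightarrow> 'a \<Rightarrow> 'a) \<Rightarrow> 'a set \<Rightarrow> 'a set" where
  "fixed_points act Q = {x \<in> Q. \<forall>s. act s x = x}"

definition nonexpansive_retract ::
    "('a::real_vector \<Rightarrow> real) set \<Rightarrow> 'a set \<Rightarrow> 'a set \<Rightarrow> bool" where
  "nonexpansive_retract \<N> F Q \<longleftrightarrow>
     F \<subseteq> Q \<and>
     (\<exists>r. r ` Q = F \<and> (\<forall>x\<in>Q. r (r x) = r x) \<and> nonexpansive_map_on \<N> Q r)"

end

theory Submission
  imports Defs
begin

text \<open>
  The classical theorem of Ryll-Nardzewski concerns affine maps. Here the maps are only
  nonexpansive, and the proof replaces barycentres by a normal-structure argument. Choose a minimal
  nonempty convex weakly compact invariant subset \<open>C\<close> of \<open>Q\<close>, and inside it a minimal nonempty weakly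
  compact invariant subset \<open>K\<close>, which need not be convex. The claim is that \<open>K\<close> is a single point.

  If the semigroup is countable, then \<open>K\<close> is the weak closure of a countable orbit, so by
  Hahn--Banach it lies in a separable subspace for each of the seminorms. Baire's theorem then
  produces nonempty relatively weakly open subsets of \<open>K\<close> of arbitrarily small diameter
  (\<open>weakly_compact_fragment\<close>). Two consequences follow. If the orbits of two points of \<open>K\<close> come
  together weakly, then minimality drives both of them into such a small open set, so they come together
  for \<open>\<tau>\<close> and the two points are equal by distality (\<open>proximal_imp_eq\<close>). Hence the only idempotent of the
  Ellis semigroup of \<open>K\<close> is the identity, this semigroup is a group, and since all its
  elements are nonexpansive the semigroup acts on \<open>K\<close> by surjective isometries (\<open>surjective_isometry\<close>).
  Pulling a small open set back by finitely many isometries shows that \<open>K\<close> is totally bounded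
  (\<open>totally_bounded\<close>). By DeMarr's averaging argument, if \<open>K\<close> has positive diameter for a seminorm \<open>p\<close>, its
  convex hull contains a point whose \<open>p\<close>-distances to \<open>K\<close> stay below some \<open>r\<close> smaller than the
  diameter (\<open>nondiametral_point\<close>). The points of \<open>C\<close> with this property form a convex closed set,
  invariant because the action maps \<open>K\<close> onto \<open>K\<close>. By minimality that set is \<open>C\<close>, which contains \<open>K\<close>,
  and this is a contradiction.

  The fixed point sets of single elements are weakly closed and every finite set of elements lies in a
  countable subsemigroup, so compactness gives a common fixed point for an arbitrary semigroup.

  The retraction comes from Bruck's method. The nonexpansive maps of \<open>Q\<close> into itself that fix
  every point of \<open>F(S)\<close> form a semigroup that is compact for pointwise weak convergence. An element \<open>f\<close> of a minimal left
  ideal can be recovered from \<open>h \<circ> f\<close> for every \<open>h\<close> in the semigroup. For each \<open>z\<close> the values at \<open>f z\<close>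
  of all these maps form a convex weakly compact invariant set, which contains a common fixed point
  \<open>w = h (f z)\<close> by the first part; recovering \<open>f z\<close> from \<open>w\<close> by a map that fixes \<open>w\<close> gives \<open>f z = w\<close>.
  Thus \<open>f\<close> retracts \<open>Q\<close> onto \<open>F(S)\<close>.
\<close>

section \<open>Minimal closed sets in compact spaces\<close>

lemma minimal_closed_subset:
  assumes "compact_space T" and "closedin T A" "A \<noteq> {}" "\<phi> A"
    and Inter: "\<And>\<C>. \<C> \<noteq> {} \<Longrightarrow> (\<And>B. B \<in> \<C> \<Longrightarrow> \<phi> B) \<Longrightarrow> \<phi> (\<Inter>\<C>)"
  obtains M where "closedin T M" "M \<noteq> {}" "\<phi> M" "M \<subseteq> A"
    "\<And>B. closedin T B \<Longrightarrow> B \<noteq> {} \<Longrightarrow> \<phi> B \<Longrightarrow> B \<subseteq> M \<Longrightarrow> B = M"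
proof -
  define P where "P = {B. closedin T B \<and> B \<noteq> {} \<and> \<phi> B \<and> B \<subseteq> A}"
  have "\<exists>M\<in>P. \<forall>B\<in>P. M \<supseteq> B \<longrightarrow> B = M"
  proof (rule predicate_Zorn)
    show "partial_order_on P (relation_of (\<supseteq>) P)"
      by (rule partial_order_on_relation_ofI) auto
  next
    fix \<C> assume \<C>: "\<C> \<in> Chains (relation_of (\<supseteq>) P)"
    then have sub: "\<C> \<subseteq> P" and lin: "\<And>B C. B \<in> \<C> \<Longrightarrow> C \<in> \<C> \<Longrightarrow> B \<subseteq> C \<or> C \<subseteq> B"
      unfolding Chains_def relation_of_def by auto
    show "\<exists>U\<in>P. \<forall>B\<in>\<C>. U \<subseteq> B"
    proof (cases "\<C> = {}")
      case True
      then show ?thesis using assms(2-4) by (auto simp: P_def)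
    next
      case False
      \<comment> \<open>A nonempty finite subchain contains its own intersection, so compactness applies to the chain.\<close>
      have "\<Inter>\<F> \<noteq> {}" if "finite \<F>" "\<F> \<subseteq> \<C>" for \<F>
      proof (cases "\<F> = {}")
        case False
        then have "\<Inter>\<F> \<in> \<F>"
          using that lin by (intro Inter_in_chain[where \<A> = UNIV]) (auto simp: subset_chain_def)
        then show ?thesis using that sub by (auto simp: P_def)
      qed auto
      moreover have "\<forall>C\<in>\<C>. closedin T C" using sub by (auto simp: P_def)
      ultimately have "\<Inter>\<C> \<noteq> {}"
        using assms(1)[unfolded compact_space_fip, rule_format, of \<C>] by simp
      moreover have "closedin T (\<Inter>\<C>)" "\<phi> (\<Inter>\<C>)" "\<Inter>\<C> \<subseteq> A"
        using False sub by (auto simp: P_def intro!: Inter)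
      ultimately show ?thesis by (auto simp: P_def intro!: bexI[of _ "\<Inter>\<C>"])
    qed
  qed
  then obtain M where "M \<in> P" "\<And>B. B \<in> P \<Longrightarrow> B \<subseteq> M \<Longrightarrow> B = M" by auto
  then show ?thesis by (intro that[of M]) (auto simp: P_def)
qed

section \<open>Compact right topological semigroups\<close>

text \<open>
  The Ellis--Numakura lemma. For \<open>e\<close> in a minimal closed subsemigroup \<open>M\<close>, the translate \<open>M e\<close> is again a
  closed subsemigroup, hence all of \<open>M\<close>; so the closed subsemigroup of all \<open>a\<close> with \<open>a e = e\<close>
  is nonempty, hence also all of \<open>M\<close>, and it contains \<open>e\<close>.
\<close>
lemma right_topological_semigroup_idempotent:
  assumes "compact_space T" "Hausdorff_space T" and E: "closedin T E" "E \<noteq> {}"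
    and closed: "\<And>a b. a \<in> E \<Longrightarrow> b \<in> E \<Longrightarrow> m a b \<in> E"
    and assoc: "\<And>a b c. a \<in> E \<Longrightarrow> b \<in> E \<Longrightarrow> c \<in> E \<Longrightarrow> m (m a b) c = m a (m b c)"
    and cont: "\<And>b. b \<in> E \<Longrightarrow> continuous_map T T (\<lambda>a. m a b)"
  obtains e where "e \<in> E" "m e e = e"
proof -
  obtain M where M: "closedin T M" "M \<noteq> {}" "\<forall>a\<in>M. \<forall>b\<in>M. m a b \<in> M" "M \<subseteq> E"
    and min: "\<And>B. closedin T B \<Longrightarrow> B \<noteq> {} \<Longrightarrow> \<forall>a\<in>B. \<forall>b\<in>B. m a b \<in> B \<Longrightarrow> B \<subseteq> M \<Longrightarrow> B = M"
  proof (rule minimal_closed_subset[of T E "\<lambda>B. \<forall>a\<in>B. \<forall>b\<in>B. m a b \<in> B"])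
    show "\<forall>a\<in>\<Inter>\<C>. \<forall>b\<in>\<Inter>\<C>. m a b \<in> \<Inter>\<C>"
      if "\<And>B. B \<in> \<C> \<Longrightarrow> \<forall>a\<in>B. \<forall>b\<in>B. m a b \<in> B" for \<C>
      using that by simp
  qed (use assms in auto)
  obtain e where e: "e \<in> M" using M by blast
  have image: "(\<lambda>a. m a e) ` M = M"
  proof (rule min)
    have "compactin T M" using M(1) assms(1) by (rule closedin_compact_space[rotated])
    then show "closedin T ((\<lambda>a. m a e) ` M)"
      using M e cont assms(2) by (meson compactin_imp_closedin image_compactin subsetD)
    have "m (m a e) (m b e) = m (m (m a e) b) e" if "a \<in> M" "b \<in> M" for a b
      using that e M assoc closed by (metis subsetD)
    moreover have "m (m a e) b \<in> M" if "a \<in> M" "b \<in> M" for a b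
      using that e M by blast
    ultimately show "\<forall>a\<in>(\<lambda>a. m a e) ` M. \<forall>b\<in>(\<lambda>a. m a e) ` M. m a b \<in> (\<lambda>a. m a e) ` M"
      by auto
  qed (use M e in auto)
  have ne: "{a \<in> M. m a e = e} \<noteq> {}"
  proof -
    have "e \<in> (\<lambda>a. m a e) ` M" using e image by simp
    then show ?thesis by (auto simp: eq_commute)
  qed
  have "{a \<in> M. m a e = e} = M"
  proof (rule min)
    have "closedin T {e}"
      using M e assms(2) by (metis closedin_Hausdorff_sing_eq closedin_subset subsetD)
    then have "closedin T {a \<in> M. m a e \<in> {e}}"
      using cont e M by (intro closedin_continuous_map_preimage_gen[of _ T]) auto
    then show "closedin T {a \<in> M. m a e = e}" by simp
    show "\<forall>a\<in>{a \<in> M. m a e = e}. \<forall>b\<in>{a \<in> M. m a e = e}. m a b \<in> {a \<in> M. m a e = e}"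
      using M e assoc by (auto simp: subset_iff)
  qed (use ne in auto)
  with e have "m e e = e" by auto
  then show ?thesis using that e M by blast
qed

text \<open>
  Any element \<open>f\<close> of a minimal closed left ideal \<open>M\<close> will do: \<open>h f\<close> lies in \<open>M\<close> and generates a closed left
  ideal \<open>E (h f)\<close>, which is \<open>M\<close> by minimality and so contains \<open>f\<close>.
\<close>
lemma right_topological_semigroup_minimal_element:
  assumes "compact_space T" "Hausdorff_space T" and E: "closedin T E" "E \<noteq> {}"
    and closed: "\<And>a b. a \<in> E \<Longrightarrow> b \<in> E \<Longrightarrow> m a b \<in> E"
    and assoc: "\<And>a b c. a \<in> E \<Longrightarrow> b \<in> E \<Longrightarrow> c \<in> E \<Longrightarrow> m (m a b) c = m a (m b c)"
    and cont: "\<And>b. b \<in> E \<Longrightarrow> continuous_map T T (\<lambda>a. m a b)"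
  obtains f where "f \<in> E" "\<forall>h\<in>E. \<exists>k\<in>E. m k (m h f) = f"
proof -
  obtain M where M: "closedin T M" "M \<noteq> {}" "\<forall>a\<in>E. \<forall>b\<in>M. m a b \<in> M" "M \<subseteq> E"
    and min: "\<And>B. closedin T B \<Longrightarrow> B \<noteq> {} \<Longrightarrow> \<forall>a\<in>E. \<forall>b\<in>B. m a b \<in> B \<Longrightarrow> B \<subseteq> M \<Longrightarrow> B = M"
  proof (rule minimal_closed_subset[of T E "\<lambda>B. \<forall>a\<in>E. \<forall>b\<in>B. m a b \<in> B"])
    show "\<forall>a\<in>E. \<forall>b\<in>\<Inter>\<C>. m a b \<in> \<Inter>\<C>"
      if "\<And>B. B \<in> \<C> \<Longrightarrow> \<forall>a\<in>E. \<forall>b\<in>B. m a b \<in> B" for \<C>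
      using that by simp
  qed (use assms in auto)
  obtain f where f: "f \<in> M" using M by blast
  have ideal: "(\<lambda>a. m a g) ` E = M" if g: "g \<in> M" for g
  proof (rule min)
    have "compactin T E" using E assms(1) closedin_compact_space by blast
    then show "closedin T ((\<lambda>a. m a g) ` E)"
      using M g cont assms(2) by (meson compactin_imp_closedin image_compactin subsetD)
    have "m a (m b g) \<in> (\<lambda>a. m a g) ` E" if "a \<in> E" "b \<in> E" for a b
      using that g M assoc closed by (metis image_eqI subsetD)
    then show "\<forall>a\<in>E. \<forall>b\<in>(\<lambda>a. m a g) ` E. m a b \<in> (\<lambda>a. m a g) ` E"
      by blast
  qed (use M E g in auto)
  have "\<exists>k\<in>E. m k (m h f) = f" if "h \<in> E" for h
    using ideal[of "m h f"] f M that by (metis (no_types, lifting) imageE)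
  then show ?thesis using that f M by blast
qed

text \<open>
  This makes every set of self-maps that is closed under composition a right topological semigroup for
  pointwise convergence: each coordinate of the composite is a coordinate of \<open>h\<close>.
\<close>
lemma continuous_map_compose_left:
  assumes b: "b \<in> (\<Pi>\<^sub>E x\<in>K. K)"
  shows "continuous_map (product_topology (\<lambda>_. T) K) (product_topology (\<lambda>_. T) K) (\<lambda>h. compose K h b)"
proof -
  have "continuous_map (product_topology (\<lambda>_. T) K) T (\<lambda>h. compose K h b x)" if "x \<in> K" for x
    using that b continuous_map_product_projection[of "b x" K "\<lambda>_. T"] by (auto simp: compose_def)
  then show ?thesis
    by (auto simp: continuous_map_componentwise)
qed

section \<open>Supporting linear functionals\<close>

definition sublinear :: "('a::real_vector \<Rightarrow> real) \<Rightarrow> bool" where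
  "sublinear q \<longleftrightarrow> (\<forall>x y. q (x + y) \<le> q x + q y) \<and> (\<forall>c x. 0 \<le> c \<longrightarrow> q (c *\<^sub>R x) = c * q x)"

lemma sublinear_0: "sublinear q \<Longrightarrow> q 0 = 0"
  unfolding sublinear_def by (metis mult_zero_left order_refl scaleR_zero_left)

lemma sublinear_minus:
  assumes "sublinear q" shows "- q (- x) \<le> q x"
proof -
  have "q (x + - x) \<le> q x + q (- x)" using assms unfolding sublinear_def by blast
  then show ?thesis using sublinear_0[OF assms] by simp
qed

text \<open>
  The modification \<open>r y\<close> of \<open>q\<close> is the largest sublinear functional below \<open>q\<close> whose value at \<open>-y\<close> is at most
  \<open>- q y\<close>, so it is linear along the line spanned by \<open>y\<close>. It serves twice: a minimal
  sublinear functional must coincide with all its modifications, and modifying before minimising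
  prescribes the value of the resulting linear functional at one point.
\<close>
lemma sublinear_reduction:
  assumes q: "sublinear q"
  defines "r \<equiv> \<lambda>y x. INF t\<in>{0..}. q (x + t *\<^sub>R y) - t * q y"
  shows "sublinear (r y)" "r y x \<le> q x" "r y (- y) \<le> - q y"
proof -
  have add: "q (a + b) \<le> q a + q b" and hom: "0 \<le> c \<Longrightarrow> q (c *\<^sub>R a) = c * q a" for a b c
    using q by (auto simp: sublinear_def)
  have bdd: "bdd_below ((\<lambda>t. q (x + t *\<^sub>R y) - t * q y) ` {0..})" for x
  proof (rule bdd_belowI2)
    fix t :: real assume "t \<in> {0..}"
    then have "t * q y = q ((x + t *\<^sub>R y) + (- x))" using hom by simp
    also have "\<dots> \<le> q (x + t *\<^sub>R y) + q (- x)" by (rule add)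
    finally show "- q (- x) \<le> q (x + t *\<^sub>R y) - t * q y" by simp
  qed
  have le: "r y x \<le> q (x + t *\<^sub>R y) - t * q y" if "0 \<le> t" for x t
    unfolding r_def using that bdd by (intro cINF_lower) auto
  have ge: "c \<le> r y x" if "\<And>t. 0 \<le> t \<Longrightarrow> c \<le> q (x + t *\<^sub>R y) - t * q y" for x c
    unfolding r_def using that by (intro cINF_greatest) auto
  show le_q: "r y x \<le> q x" for x using le[of 0 x] by simp
  show "r y (- y) \<le> - q y" using le[of 1 "- y"] sublinear_0[OF q] by simp
  have r_add: "r y (a + b) \<le> r y a + r y b" for a b
  proof -
    have "r y (a + b) - (q (a + s *\<^sub>R y) - s * q y) \<le> r y b" if s: "0 \<le> s" for s
    proof (rule ge)
      fix t :: real assume t: "0 \<le> t"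
      have "r y (a + b) \<le> q ((a + s *\<^sub>R y) + (b + t *\<^sub>R y)) - (s + t) * q y"
        using le[of "s + t" "a + b"] s t by (simp add: algebra_simps)
      also have "\<dots> \<le> (q (a + s *\<^sub>R y) + q (b + t *\<^sub>R y)) - (s + t) * q y"
        using add by simp
      finally show "r y (a + b) - (q (a + s *\<^sub>R y) - s * q y) \<le> q (b + t *\<^sub>R y) - t * q y"
        by (simp add: algebra_simps)
    qed
    then have "r y (a + b) - r y b \<le> r y a" by (intro ge) (smt (verit))
    then show ?thesis by simp
  qed
  have r_hom_le: "r y (c *\<^sub>R x) \<le> c * r y x" if c: "0 < c" for c x
  proof -
    have "r y (c *\<^sub>R x) / c \<le> r y x"
    proof (rule ge)
      fix t :: real assume t: "0 \<le> t"
      have "r y (c *\<^sub>R x) \<le> q (c *\<^sub>R (x + t *\<^sub>R y)) - (c * t) * q y"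
        using le[of "c * t" "c *\<^sub>R x"] c t by (simp add: algebra_simps)
      also have "\<dots> = c * (q (x + t *\<^sub>R y) - t * q y)"
        using hom[of c "x + t *\<^sub>R y"] c by (simp add: right_diff_distrib)
      finally show "r y (c *\<^sub>R x) / c \<le> q (x + t *\<^sub>R y) - t * q y"
        using c by (simp add: field_simps)
    qed
    then show ?thesis using c by (simp add: field_simps)
  qed
  have r0: "r y 0 = 0"
  proof (rule antisym)
    show "r y 0 \<le> 0" using le_q[of 0] sublinear_0[OF q] by simp
    show "0 \<le> r y 0" by (rule ge) (simp add: hom)
  qed
  have "r y (c *\<^sub>R x) = c * r y x" if c: "0 \<le> c" for c x
  proof (cases "c = 0")
    case False
    then have c: "0 < c" using c by simp
    have "r y x \<le> inverse c * r y (c *\<^sub>R x)"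
      using r_hom_le[of "inverse c" "c *\<^sub>R x"] c by simp
    then show ?thesis using r_hom_le[OF c, of x] c by (simp add: field_simps)
  qed (simp add: r0)
  then show "sublinear (r y)" unfolding sublinear_def using r_add by blast
qed

text \<open>
  The Hahn--Banach theorem without extension from subspaces: Zorn's lemma yields a minimal sublinear
  functional below \<open>p\<close>, and minimality against \<open>sublinear_reduction\<close> forces additivity.
\<close>
lemma linear_below_sublinear:
  assumes p: "sublinear p"
  obtains f where "linear f" "f \<le> p"
proof -
  define A where "A = {q. sublinear q \<and> q \<le> p}"
  have "\<exists>m\<in>A. \<forall>q\<in>A. m \<ge> q \<longrightarrow> q = m"
  proof (rule predicate_Zorn)
    show "partial_order_on A (relation_of (\<lambda>q q'. q \<ge> q') A)"
      by (rule partial_order_on_relation_ofI) auto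
  next
    fix \<C> assume \<C>: "\<C> \<in> Chains (relation_of (\<lambda>q q'. q \<ge> q') A)"
    then have sub: "\<C> \<subseteq> A" and lin: "\<And>q q'. q \<in> \<C> \<Longrightarrow> q' \<in> \<C> \<Longrightarrow> q \<le> q' \<or> q' \<le> q"
      unfolding Chains_def relation_of_def by auto
    show "\<exists>u\<in>A. \<forall>q\<in>\<C>. u \<le> q"
    proof (cases "\<C> = {}")
      case True
      then show ?thesis using p by (auto simp: A_def)
    next
      case False
      define u where "u x = (INF q\<in>\<C>. q x)" for x
      have bdd: "bdd_below ((\<lambda>q. q x) ` \<C>)" for x
      proof (rule bdd_belowI2)
        fix q assume "q \<in> \<C>"
        then have q: "sublinear q" "q \<le> p" using sub by (auto simp: A_def)
        then have "- p (- x) \<le> - q (- x)" by (auto simp: le_fun_def)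
        then show "- p (- x) \<le> q x" using sublinear_minus[OF q(1), of x] by simp
      qed
      have le: "u x \<le> q x" if "q \<in> \<C>" for q x
        unfolding u_def using that bdd by (intro cINF_lower)
      have ge: "c \<le> u x" if "\<And>q. q \<in> \<C> \<Longrightarrow> c \<le> q x" for c x
        unfolding u_def using that False by (intro cINF_greatest)
      have "u (x + y) \<le> u x + u y" for x y
      proof -
        have "u (x + y) - q x \<le> u y" if q: "q \<in> \<C>" for q
        proof (rule ge)
          fix q' assume q': "q' \<in> \<C>"
          have "\<exists>q''\<in>\<C>. q'' \<le> q \<and> q'' \<le> q'" using lin[OF q q'] q q' by auto
          then obtain q'' where q'': "q'' \<in> \<C>" "q'' \<le> q" "q'' \<le> q'" by blast
          have "u (x + y) \<le> q'' (x + y)" by (rule le[OF q''(1)])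
          also have "\<dots> \<le> q'' x + q'' y" using q'' sub by (auto simp: A_def sublinear_def)
          also have "\<dots> \<le> q x + q' y" using q'' by (intro add_mono) (auto simp: le_fun_def)
          finally show "u (x + y) - q x \<le> q' y" by simp
        qed
        then have "u (x + y) - u y \<le> u x" by (intro ge) (smt (verit))
        then show ?thesis by simp
      qed
      moreover have "u (c *\<^sub>R x) = c * u x" if c: "0 \<le> c" for c x
      proof (rule antisym)
        have hom: "q (c *\<^sub>R x) = c * q x" if "q \<in> \<C>" for q
          using that sub c by (auto simp: A_def sublinear_def)
        show "c * u x \<le> u (c *\<^sub>R x)"
        proof (rule ge)
          show "c * u x \<le> q (c *\<^sub>R x)" if "q \<in> \<C>" for q
            using hom[OF that] le[OF that, of x] c by (simp add: mult_left_mono)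
        qed
        show "u (c *\<^sub>R x) \<le> c * u x"
        proof (cases "c = 0")
          case True
          obtain q where "q \<in> \<C>" using False by blast
          then show ?thesis using le[of q 0] sub True
            by (auto simp: A_def dest!: subsetD sublinear_0)
        next
          case False
          with c have c: "0 < c" by simp
          have "u (c *\<^sub>R x) / c \<le> u x"
          proof (rule ge)
            fix q assume "q \<in> \<C>"
            from le[OF this, of "c *\<^sub>R x"] hom[OF this] c
            show "u (c *\<^sub>R x) / c \<le> q x" by (simp add: field_simps)
          qed
          then show ?thesis using c by (simp add: field_simps)
        qed
      qed
      ultimately have "sublinear u" by (simp add: sublinear_def)
      moreover have "u \<le> p"
      proof -
        obtain q where q: "q \<in> \<C>" using False by blast
        then have "q \<le> p" using sub by (auto simp: A_def)
        then show ?thesis using le[OF q] unfolding le_fun_def by (metis order_trans)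
      qed
      ultimately show ?thesis using le unfolding A_def le_fun_def by blast
    qed
  qed
  then obtain m where m: "sublinear m" "m \<le> p" and min: "\<And>q. sublinear q \<Longrightarrow> q \<le> p \<Longrightarrow> q \<le> m \<Longrightarrow> q = m"
    by (auto simp: A_def)
  have add: "m (x + y) = m x + m y" for x y
  proof (rule antisym)
    show "m (x + y) \<le> m x + m y" using m by (auto simp: sublinear_def)
    define r where "r x = (INF t\<in>{0..}. m (x + t *\<^sub>R y) - t * m y)" for x
    note red = sublinear_reduction[OF m(1), where y = y, folded r_def]
    have "r = m"
      using red(1,2) m(2) by (intro min) (auto simp: le_fun_def intro: order_trans[OF red(2)])
    then have "m (- y) \<le> - m y" using red(3) by simp
    moreover have "m x \<le> m (x + y) + m (- y)"
      using m(1)[unfolded sublinear_def, THEN conjunct1, rule_format, of "x + y" "- y"] by simp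
    ultimately show "m x + m y \<le> m (x + y)" by simp
  qed
  have neg: "m (- x) = - m x" for x
    using add[of x "- x"] sublinear_0[OF m(1)] by simp
  have "m (c *\<^sub>R x) = c *\<^sub>R m x" for c x
  proof (cases "0 \<le> c")
    case True
    then show ?thesis using m by (auto simp: sublinear_def)
  next
    case False
    then have "m (c *\<^sub>R x) = - m ((- c) *\<^sub>R x)" using neg[of "c *\<^sub>R x"] by simp
    also have "\<dots> = c * m x" using m(1)[unfolded sublinear_def, THEN conjunct2, rule_format, of "- c" x] False by simp
    finally show ?thesis by simp
  qed
  then have "linear m" using add by (intro linearI)
  then show ?thesis using m that by blast
qed

lemma hahn_banach_support:
  assumes q: "sublinear q"
  obtains f where "linear f" "\<And>y. f y \<le> q y" "f x = q x"
proof -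
  define r where "r z = (INF t\<in>{0..}. q (z + t *\<^sub>R x) - t * q x)" for z
  note red = sublinear_reduction[OF q, where y = x, folded r_def]
  obtain f where f: "linear f" "f \<le> r" using linear_below_sublinear[OF red(1)] .
  have "f y \<le> q y" for y using f(2) red(2) unfolding le_fun_def by (metis order_trans)
  moreover have "f (- x) \<le> - q x" using f(2) red(3) unfolding le_fun_def by (metis order_trans)
  then have "q x \<le> f x" using f(1) by (simp add: linear_neg)
  ultimately show ?thesis using that f(1) by (metis antisym)
qed

section \<open>The weak topology of a family of seminorms\<close>

lemma
  assumes "seminorm p"
  shows seminorm_nonneg: "0 \<le> p x"
    and seminorm_triangle: "p (x + y) \<le> p x + p y"
    and seminorm_scaleR: "p (c *\<^sub>R x) = \<bar>c\<bar> * p x"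
    and seminorm_0: "p 0 = 0"
    and seminorm_minus: "p (- x) = p x"
    and seminorm_diff_commute: "p (x - y) = p (y - x)"
    and seminorm_diff_triangle: "p (x - y) \<le> p (x - z) + p (z - y)"
proof -
  show "0 \<le> p x" "p (x + y) \<le> p x + p y" and sc: "p (c *\<^sub>R x) = \<bar>c\<bar> * p x" for c x y
    using assms by (auto simp: seminorm_def)
  show "p 0 = 0" using sc[of 0 0] by simp
  show m: "p (- x) = p x" for x using sc[of "-1" x] by simp
  show "p (x - y) = p (y - x)" using m[of "x - y"] by simp
  have "p ((x - z) + (z - y)) \<le> p (x - z) + p (z - y)"
    using assms unfolding seminorm_def by blast
  then show "p (x - y) \<le> p (x - z) + p (z - y)" by simp
qed

lemma seminorm_sum_le:
  assumes p: "seminorm p" and "finite A"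
  shows "p (\<Sum>a\<in>A. f a) \<le> (\<Sum>a\<in>A. p (f a))"
  using assms(2)
proof induction
  case empty
  then show ?case using seminorm_0[OF p] by simp
next
  case (insert a A)
  then show ?case using seminorm_triangle[OF p, of "f a" "sum f A"] by simp
qed

lemma sublinear_seminorm: "seminorm p \<Longrightarrow> sublinear p"
  unfolding seminorm_def sublinear_def by simp

locale seminorm_family =
  fixes N :: "('a::real_vector \<Rightarrow> real) set"
  assumes seminorm_N: "p \<in> N \<Longrightarrow> seminorm p"
begin

abbreviation weak :: "'a topology" where
  "weak \<equiv> weak_topology (seminorm_topology N)"

definition dual :: "('a \<Rightarrow> real) set" where
  "dual = {f. linear f \<and> continuous_map (seminorm_topology N) euclideanreal f}"

text \<open>
  The family is not directed, so the finite sums of its members play the role of the basic continuous seminorms.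
\<close>
definition psum :: "('a \<Rightarrow> real) set \<Rightarrow> 'a \<Rightarrow> real" where
  "psum F x = (\<Sum>p\<in>F. p x)"

lemma psum_singleton [simp]: "psum {p} = p"
  by (auto simp: psum_def)

lemma seminorm_psum: assumes "F \<subseteq> N" shows "seminorm (psum F)"
proof -
  have "psum F (x + y) \<le> psum F x + psum F y" for x y
    unfolding psum_def sum.distrib[symmetric]
    using assms seminorm_N by (intro sum_mono) (auto simp: seminorm_def)
  moreover have "psum F (c *\<^sub>R x) = \<bar>c\<bar> * psum F x" for c x
    unfolding psum_def sum_distrib_left
    using assms seminorm_N by (intro sum.cong) (auto simp: seminorm_def subset_iff)
  moreover have "0 \<le> psum F x" for x
    unfolding psum_def
    using assms seminorm_N by (intro sum_nonneg) (auto simp: seminorm_def)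
  ultimately show ?thesis by (simp add: seminorm_def)
qed

text \<open>
  Every use of \<open>\<tau>\<close> passes through this description of its open sets: the seminorms separate points, functionals
  dominated by a finite sum are continuous, and distality yields a gap.
\<close>
lemma openin_seminorm_topology:
  "openin (seminorm_topology N) W \<longleftrightarrow>
     (\<forall>a\<in>W. \<exists>F e. finite F \<and> F \<subseteq> N \<and> 0 < e \<and> (\<forall>x. psum F (x - a) < e \<longrightarrow> x \<in> W))"
  (is "_ \<longleftrightarrow> ?R W")
proof
  assume "openin (seminorm_topology N) W"
  then have "generate_topology_on (insert UNIV {{x. p (x - a) < e} | p a e. p \<in> N \<and> 0 < e}) W"
    unfolding seminorm_topology_def by (rule openin_topology_generated_by)
  then show "?R W"
  proof induction
    case (Int A B)
    show ?case
    proof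
      fix a assume a: "a \<in> A \<inter> B"
      obtain F e where F: "finite F" "F \<subseteq> N" "0 < e" "\<And>x. psum F (x - a) < e \<Longrightarrow> x \<in> A"
        using bspec[OF Int.IH(1) IntD1[OF a]] by metis
      obtain F' e' where F': "finite F'" "F' \<subseteq> N" "0 < e'" "\<And>x. psum F' (x - a) < e' \<Longrightarrow> x \<in> B"
        using bspec[OF Int.IH(2) IntD2[OF a]] by metis
      have mono: "psum G x \<le> psum (F \<union> F') x" if "G = F \<or> G = F'" for G x
        unfolding psum_def using that F F' seminorm_N
        by (intro sum_mono2) (auto simp: seminorm_def subset_iff)
      have "x \<in> A \<inter> B" if "psum (F \<union> F') (x - a) < min e e'" for x
      proof -
        have "psum F (x - a) < e" "psum F' (x - a) < e'"
          using that mono[of F "x - a"] mono[of F' "x - a"] by auto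
        then show ?thesis using F(4) F'(4) by blast
      qed
      then show "\<exists>F e. finite F \<and> F \<subseteq> N \<and> 0 < e \<and> (\<forall>x. psum F (x - a) < e \<longrightarrow> x \<in> A \<inter> B)"
        using F F' by (intro exI[of _ "F \<union> F'"] exI[of _ "min e e'"]) auto
    qed
  next
    case (UN K)
    then show ?case by (meson UnionE UnionI)
  next
    case (Basis s)
    show ?case
    proof
      fix a assume a: "a \<in> s"
      from Basis consider "s = UNIV" | p b e where "s = {x. p (x - b) < e}" "p \<in> N" "0 < e"
        by auto
      then show "\<exists>F e. finite F \<and> F \<subseteq> N \<and> 0 < e \<and> (\<forall>x. psum F (x - a) < e \<longrightarrow> x \<in> s)"
      proof cases
        case 1
        then show ?thesis by (intro exI[of _ "{}"] exI[of _ 1]) auto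
      next
        case 2
        have "x \<in> s" if "p (x - a) < e - p (a - b)" for x
          using that seminorm_diff_triangle[OF seminorm_N[OF 2(2)], of x b a] 2(1) by auto
        then show ?thesis using 2 a
          by (intro exI[of _ "{p}"] exI[of _ "e - p (a - b)"]) auto
      qed
    qed
  qed simp
next
  assume R: "?R W"
  show "openin (seminorm_topology N) W"
  proof (subst openin_subopen, intro ballI)
    fix a assume a: "a \<in> W"
    obtain F e where F: "finite F" "F \<subseteq> N" "0 < e" "\<And>x. psum F (x - a) < e \<Longrightarrow> x \<in> W"
      using bspec[OF R a] by metis
    \<comment> \<open>The increment by one makes the bound \<open>card F * d < e\<close> strict, and allows \<open>F\<close> to be empty.\<close>
    define d where "d = e / (real (card F) + 1)"
    have d: "0 < d" using F by (simp add: d_def)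
    define V where "V = \<Inter>(insert UNIV ((\<lambda>p. {x. p (x - a) < d}) ` F))"
    have "openin (seminorm_topology N) V"
      unfolding V_def seminorm_topology_def using F d
      by (intro openin_Inter) (auto intro!: topology_generated_by_Basis)
    moreover have "a \<in> V" using F d by (auto simp: V_def seminorm_0[OF seminorm_N])
    moreover have "V \<subseteq> W"
    proof
      fix x assume "x \<in> V"
      then have "psum F (x - a) \<le> real (card F) * d"
        unfolding psum_def by (intro sum_bounded_above) (force simp: V_def)
      also have "\<dots> < e" using F by (simp add: d_def field_simps)
      finally show "x \<in> W" by (rule F(4))
    qed
    ultimately show "\<exists>T. openin (seminorm_topology N) T \<and> a \<in> T \<and> T \<subseteq> W" by blast
  qed
qed

lemma topspace_seminorm_topology [simp]: "topspace (seminorm_topology N) = UNIV"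
  unfolding seminorm_topology_def by auto

lemma dual_if_dominated:
  assumes f: "linear f" and F: "finite F" "F \<subseteq> N" and le: "\<And>x. f x \<le> psum F x"
  shows "f \<in> dual"
proof -
  have abs: "\<bar>f x\<bar> \<le> psum F x" for x
    using le[of x] le[of "- x"] f seminorm_minus[OF seminorm_psum[OF F(2)], of x]
    by (simp add: linear_neg)
  have "openin (seminorm_topology N) (f -` U)" if U: "open U" for U
    unfolding openin_seminorm_topology
  proof
    fix a assume "a \<in> f -` U"
    then obtain e where e: "0 < e" "\<And>y. \<bar>y - f a\<bar> < e \<Longrightarrow> y \<in> U"
      using U unfolding open_dist dist_real_def by (metis vimageD)
    have "x \<in> f -` U" if "psum F (x - a) < e" for x
      using abs[of "x - a"] that f by (auto intro!: e(2) simp: linear_diff)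
    then show "\<exists>F e. finite F \<and> F \<subseteq> N \<and> 0 < e \<and> (\<forall>x. psum F (x - a) < e \<longrightarrow> x \<in> f -` U)"
      using F e by blast
  qed
  then show ?thesis using f unfolding dual_def continuous_map_alt by simp
qed

lemma supporting_functional:
  assumes "finite F" "F \<subseteq> N"
  obtains f where "f \<in> dual" "\<And>y. f y \<le> psum F y" "f x = psum F x"
  using hahn_banach_support[OF sublinear_seminorm[OF seminorm_psum[OF assms(2)]], of x]
    dual_if_dominated assms by metis

lemma topspace_weak [simp]: "topspace weak = UNIV"
proof -
  have "(\<lambda>x::'a. 0::real) -` UNIV \<in> {f -` U | (f :: 'a \<Rightarrow> real) U. linear f \<and> continuous_map (seminorm_topology N) euclideanreal f \<and> open U}"
    by (intro CollectI exI[of _ "\<lambda>x. 0"] exI[of _ UNIV]) (auto simp: linear_zero)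
  then show ?thesis unfolding weak_topology_def by (auto intro!: UnionI)
qed

lemma openin_weak_vimage: "f \<in> dual \<Longrightarrow> open U \<Longrightarrow> openin weak (f -` U)"
  unfolding weak_topology_def dual_def by (rule topology_generated_by_Basis) blast

lemma continuous_map_dual: "f \<in> dual \<Longrightarrow> continuous_map weak euclideanreal f"
  unfolding continuous_map_alt
  by (simp add: openin_weak_vimage)

lemma linear_dual: "f \<in> dual \<Longrightarrow> linear f"
  by (simp add: dual_def)

text \<open>
  Weak lower semicontinuity of a continuous seminorm: it is the supremum of the functionals that it
  dominates. Stating it for two continuous maps \<open>g\<close> and \<open>h\<close> covers closed balls as well as the sets of
  maps defined by nonexpansiveness or by a fixed point condition.
\<close>
lemma closedin_psum_le:
  assumes F: "finite F" "F \<subseteq> N"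
    and g: "continuous_map T weak g" and h: "continuous_map T weak h"
  shows "closedin T {x \<in> topspace T. psum F (g x - h x) \<le> c}"
proof -
  define A where "A = {f\<in>dual. \<forall>y. f y \<le> psum F y}"
  have "psum F z \<le> c \<longleftrightarrow> (\<forall>f\<in>A. f z \<le> c)" for z
  proof
    show "psum F z \<le> c \<Longrightarrow> \<forall>f\<in>A. f z \<le> c" by (auto simp: A_def intro: order_trans)
    obtain f where "f \<in> A" "f z = psum F z"
      using supporting_functional[OF F, of z] by (auto simp: A_def)
    then show "\<forall>f\<in>A. f z \<le> c \<Longrightarrow> psum F z \<le> c" by force
  qed
  then have eq: "{x \<in> topspace T. psum F (g x - h x) \<le> c} =
      \<Inter>(insert (topspace T) ((\<lambda>f. {x \<in> topspace T. f (g x) - f (h x) \<in> {..c}}) ` A))"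
    by (auto simp: A_def linear_diff[OF linear_dual])
  have "closedin T {x \<in> topspace T. f (g x) - f (h x) \<in> {..c}}" if "f \<in> A" for f
  proof (rule closedin_continuous_map_preimage)
    have "f \<in> dual" using that by (simp add: A_def)
    then show "continuous_map T euclideanreal (\<lambda>x. f (g x) - f (h x))"
      using continuous_map_compose[OF g continuous_map_dual]
        continuous_map_compose[OF h continuous_map_dual]
      by (intro continuous_map_diff) (auto simp: o_def)
  qed simp
  then show ?thesis unfolding eq by (intro closedin_Inter) auto
qed

lemma Hausdorff_imp_separating:
  assumes "Hausdorff_space (seminorm_topology N)" "x \<noteq> 0"
  shows "\<exists>p\<in>N. p x \<noteq> 0"
proof (rule ccontr)
  assume "\<not> ?thesis"
  then have zero: "psum F x = 0" if "F \<subseteq> N" for F using that by (auto simp: psum_def intro!: sum.neutral)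
  obtain U where U: "openin (seminorm_topology N) U" "0 \<in> U" "x \<notin> U"
    using assms unfolding Hausdorff_space_def disjnt_def by (metis UNIV_I disjoint_iff topspace_seminorm_topology)
  obtain F e where "F \<subseteq> N" "0 < e" "\<And>z. psum F (z - 0) < e \<Longrightarrow> z \<in> U"
    using U(1,2) unfolding openin_seminorm_topology by metis
  then show False using zero U(3) by fastforce
qed

end

locale separating_seminorms = seminorm_family +
  assumes separating: "x \<noteq> 0 \<Longrightarrow> \<exists>p\<in>N. p x \<noteq> 0"
begin

lemma eq_iff_seminorms: "x = y \<longleftrightarrow> (\<forall>p\<in>N. p (x - y) \<le> 0)"
proof
  assume *: "\<forall>p\<in>N. p (x - y) \<le> 0"
  have "p (x - y) = 0" if "p \<in> N" for p
    using * that seminorm_nonneg[OF seminorm_N[OF that], of "x - y"] by force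
  then show "x = y" using separating[of "x - y"] by auto
qed (simp add: seminorm_0[OF seminorm_N])

lemma Hausdorff_weak: "Hausdorff_space weak"
  unfolding Hausdorff_space_def
proof (intro allI impI)
  fix x y assume "x \<in> topspace weak \<and> y \<in> topspace weak \<and> x \<noteq> y"
  then obtain p where p: "p \<in> N" "p (x - y) \<noteq> 0" using separating[of "x - y"] by auto
  obtain f where f: "f \<in> dual" "f (x - y) = p (x - y)"
    using supporting_functional[of "{p}" "x - y"] p by auto
  then have ne: "f x \<noteq> f y" using p by (auto simp: linear_diff linear_dual)
  then obtain U V where UV: "open U" "open V" "f x \<in> U" "f y \<in> V" "U \<inter> V = {}"
    using hausdorff by metis
  have "openin weak {z \<in> topspace weak. f z \<in> W}" if "open W" for W
    using openin_continuous_map_preimage[OF continuous_map_dual[OF f(1)], of W] that by simp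
  then show "\<exists>U V. openin weak U \<and> openin weak V \<and> x \<in> U \<and> y \<in> V \<and> disjnt U V"
    using UV by (intro exI[of _ "{z \<in> topspace weak. f z \<in> U}"] exI[of _ "{z \<in> topspace weak. f z \<in> V}"])
      (auto simp: disjnt_def)
qed

text \<open>
  The weak closure of a countable set stays inside the seminorm closure of its span, since the
  distance to the span is a seminorm and a functional supporting it at a remote point would separate that
  point weakly from \<open>D\<close>. The span is separable because rational combinations are dense in it.
\<close>
lemma weak_closure_separable:
  assumes F: "finite F" "F \<subseteq> N" and D: "countable D"
  obtains C where "countable C"
    "\<And>x e. x \<in> weak closure_of D \<Longrightarrow> 0 < e \<Longrightarrow> \<exists>c\<in>C. psum F (x - c) < e"
proof -
  note q = seminorm_psum[OF F(2)]
  define comb where "comb l = sum_list (map (\<lambda>(r, d). (of_rat r :: real) *\<^sub>R d) l)" for l :: "(rat \<times> 'a) list"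
  define C where "C = comb ` lists (UNIV \<times> D)"
  have "countable C" unfolding C_def using D by (intro countable_image countable_lists) auto
  have span_approx: "\<exists>c\<in>C. psum F (y - c) < e" if "y \<in> span D" "0 < e" for y e
    using that
  proof (induction arbitrary: e rule: span_induct_alt)
    case base
    have "comb [] \<in> C" unfolding C_def by auto
    then show ?case using base seminorm_0[OF q] by (intro bexI[of _ "comb []"]) (auto simp: comb_def)
  next
    case (step a x y)
    obtain c where c: "c \<in> C" "psum F (y - c) < e / 2"
      using step.IH[of "e / 2"] step.prems by auto
    define d where "d = e / (2 * (psum F x + 1))"
    have pos: "0 \<le> psum F x" using seminorm_nonneg[OF q] .
    then have d: "0 < d" using step.prems by (simp add: d_def)
    obtain r where r: "a < of_rat r" "of_rat r < a + d" using of_rat_dense[of a "a + d"] d by auto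
    obtain l where l: "l \<in> lists (UNIV \<times> D)" "c = comb l" using c by (auto simp: C_def)
    have "comb ((r, x) # l) \<in> C" unfolding C_def using l step.hyps by (intro imageI) auto
    moreover have "psum F (a *\<^sub>R x + y - comb ((r, x) # l)) < e"
    proof -
      have eq: "a *\<^sub>R x + y - comb ((r, x) # l) = (a - of_rat r) *\<^sub>R x + (y - c)"
        using l by (simp add: comb_def algebra_simps)
      have "psum F (a *\<^sub>R x + y - comb ((r, x) # l)) \<le> \<bar>a - of_rat r\<bar> * psum F x + psum F (y - c)"
        unfolding eq using seminorm_triangle[OF q, of "(a - of_rat r) *\<^sub>R x" "y - c"]
        by (simp add: seminorm_scaleR[OF q])
      also have "\<bar>a - of_rat r\<bar> * psum F x \<le> d * psum F x"
        using r pos by (intro mult_right_mono) auto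
      also have "d * psum F x \<le> e / 2" using pos step.prems by (simp add: d_def field_simps)
      finally show ?thesis using c by simp
    qed
    ultimately show ?case by blast
  qed
  have near_span: "\<exists>y\<in>span D. psum F (x - y) < e" if x: "x \<in> weak closure_of D" and e: "0 < e" for x e
  proof (rule ccontr)
    assume "\<not> ?thesis"
    then have far: "e \<le> psum F (x - y)" if "y \<in> span D" for y using that by force
    \<comment> \<open>The distance to the span: a sublinear functional that vanishes on \<open>D\<close> and is at least \<open>e\<close> at \<open>x\<close>.\<close>
    define r where "r z = (INF y\<in>span D. psum F (z - y))" for z
    have bdd: "bdd_below ((\<lambda>y. psum F (z - y)) ` span D)" for z
      using seminorm_nonneg[OF q] by (intro bdd_belowI2)
    have le: "r z \<le> psum F (z - y)" if "y \<in> span D" for y z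
      unfolding r_def using bdd that by (intro cINF_lower)
    have ge: "c \<le> r z" if "\<And>y. y \<in> span D \<Longrightarrow> c \<le> psum F (z - y)" for c z
      unfolding r_def using that span_zero by (intro cINF_greatest) auto
    have r_nonneg: "0 \<le> r z" for z using seminorm_nonneg[OF q] by (rule ge)
    have "r (z + z') \<le> r z + r z'" for z z'
    proof -
      have "r (z + z') - psum F (z - y) \<le> r z'" if y: "y \<in> span D" for y
      proof (rule ge)
        fix y' assume y': "y' \<in> span D"
        have "r (z + z') \<le> psum F ((z - y) + (z' - y'))"
          using le[OF span_add[OF y y'], of "z + z'"] by (simp add: algebra_simps)
        also have "\<dots> \<le> psum F (z - y) + psum F (z' - y')" by (rule seminorm_triangle[OF q])
        finally show "r (z + z') - psum F (z - y) \<le> psum F (z' - y')" by simp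
      qed
      then have "r (z + z') - r z' \<le> r z" by (intro ge) (smt (verit))
      then show ?thesis by simp
    qed
    moreover have "r (c *\<^sub>R z) = c * r z" if c: "0 \<le> c" for c z
    proof (cases "c = 0")
      case True
      have "r 0 \<le> 0" using le[OF span_zero, of 0] seminorm_0[OF q] by simp
      then show ?thesis using True r_nonneg[of 0] by simp
    next
      case False
      with c have c: "0 < c" by simp
      have half: "r (b *\<^sub>R w) / b \<le> r w" if b: "0 < b" for b w
      proof (rule ge)
        fix y assume "y \<in> span D"
        then have "r (b *\<^sub>R w) \<le> psum F (b *\<^sub>R w - b *\<^sub>R y)" by (intro le span_scale)
        also have "\<dots> = b * psum F (w - y)"
          using b seminorm_scaleR[OF q, of b "w - y"] by (simp add: scaleR_diff_right)
        finally show "r (b *\<^sub>R w) / b \<le> psum F (w - y)" using b by (simp add: field_simps)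
      qed
      have "r z * c \<le> r (c *\<^sub>R z)" using half[of "inverse c" "c *\<^sub>R z"] c by (simp add: field_simps)
      then show ?thesis using half[OF c, of z] c by (simp add: field_simps)
    qed
    ultimately have "sublinear r" by (simp add: sublinear_def)
    then obtain f where f: "linear f" "\<And>y. f y \<le> r y" "f x = r x"
      using hahn_banach_support by blast
    have "r z \<le> psum F z" for z using le[OF span_zero, of z] by simp
    then have fd: "f \<in> dual" using f F by (intro dual_if_dominated[of f F]) (auto intro: order_trans)
    have f0: "f y \<le> 0" if "y \<in> D" for y
    proof -
      have "r y \<le> psum F (y - y)" using that by (intro le span_base)
      then show ?thesis using f(2)[of y] seminorm_0[OF q] by simp
    qed
    have "closedin weak {z \<in> topspace weak. f z \<in> {..0}}"
      using continuous_map_dual[OF fd] by (intro closedin_continuous_map_preimage) auto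
    then have "weak closure_of D \<subseteq> {z \<in> topspace weak. f z \<in> {..0}}"
      using f0 by (intro closure_of_minimal) auto
    then have "f x \<le> 0" using x by auto
    moreover have "e \<le> r x" by (rule ge) (rule far)
    ultimately show False using f(3) e by simp
  qed
  have "\<exists>c\<in>C. psum F (x - c) < e" if x: "x \<in> weak closure_of D" and e: "0 < e" for x e
  proof -
    obtain y where y: "y \<in> span D" "psum F (x - y) < e / 2" using near_span[OF x, of "e / 2"] e by auto
    obtain c where c: "c \<in> C" "psum F (y - c) < e / 2" using span_approx[OF y(1), of "e/2"] e by auto
    show ?thesis using seminorm_diff_triangle[OF q, of x c y] y c by (intro bexI[of _ c]) auto
  qed
  then show ?thesis using that \<open>countable C\<close> by blast
qed

text \<open>
  Countably many small balls cover \<open>K\<close>. They are weakly closed and \<open>K\<close> is a compact Hausdorff space, so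
  by Baire's theorem one of them has interior in \<open>K\<close>.
\<close>
lemma weakly_compact_fragment:
  assumes F: "finite F" "F \<subseteq> N" and K: "compactin weak K" "K \<noteq> {}"
    and D: "countable D" "K \<subseteq> weak closure_of D" and e: "0 < e"
  obtains U where "openin (subtopology weak K) U" "U \<noteq> {}"
    "\<And>x y. x \<in> U \<Longrightarrow> y \<in> U \<Longrightarrow> psum F (x - y) < e"
proof -
  note q = seminorm_psum[OF F(2)]
  define T where "T = subtopology weak K"
  have top: "topspace T = K" by (simp add: T_def)
  have "compact_space T" using K by (simp add: T_def compact_space_subtopology)
  moreover have "Hausdorff_space T" unfolding T_def by (intro Hausdorff_space_subtopology Hausdorff_weak)
  ultimately have T: "locally_compact_space T" "regular_space T"
    by (auto intro: compact_imp_locally_compact_space compact_Hausdorff_imp_regular_space)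
  obtain C where C: "countable C" "\<And>x e. x \<in> weak closure_of D \<Longrightarrow> 0 < e \<Longrightarrow> \<exists>c\<in>C. psum F (x - c) < e"
    using weak_closure_separable[OF F D(1)] by blast
  define B where "B c = {x \<in> topspace T. psum F (x - c) \<le> e / 3}" for c
  have closed: "closedin T (B c)" for c
    unfolding B_def using F
    by (intro closedin_psum_le) (auto simp: T_def intro: continuous_map_from_subtopology)
  have cover: "\<Union>(B ` C) = topspace T"
  proof
    show "topspace T \<subseteq> \<Union> (B ` C)"
    proof
      fix x assume x: "x \<in> topspace T"
      then obtain c where "c \<in> C" "psum F (x - c) < e / 3" using C(2)[of x "e/3"] D e top by auto
      then show "x \<in> \<Union> (B ` C)" using x by (force simp: B_def)
    qed
  qed (auto simp: B_def)
  have "\<exists>c\<in>C. T interior_of B c \<noteq> {}"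
  proof (rule ccontr)
    assume "\<not> ?thesis"
    then have "T interior_of \<Union>(B ` C) = {}"
      using T C closed by (intro Baire_category_alt) auto
    then show False using cover K(2) top by (metis interior_of_topspace)
  qed
  then obtain c where c: "T interior_of B c \<noteq> {}" by blast
  have "psum F (x - y) < e" if "x \<in> T interior_of B c" "y \<in> T interior_of B c" for x y
  proof -
    have "x \<in> B c" "y \<in> B c" using that interior_of_subset[of T "B c"] by auto
    then have "psum F (x - c) \<le> e / 3" "psum F (y - c) \<le> e / 3" by (auto simp: B_def)
    then show ?thesis
      using seminorm_diff_triangle[OF q, of x y c] seminorm_diff_commute[OF q, of y c] e by linarith
  qed
  then show ?thesis using that[of "T interior_of B c"] c by (simp add: T_def)
qed

end

section \<open>Minimal distal systems act by surjective isometries\<close>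

text \<open>
  The semigroup is a set \<open>G\<close> of maps on the whole space, so closure under composition can only be asked
  for their values on \<open>K\<close>. Distality is stated by a finite sum of seminorms and a gap \<open>e\<close>, which is what
  it means that \<open>0\<close> is not in the \<open>\<tau>\<close>-closure of the differences.
\<close>

locale minimal_distal_system = separating_seminorms N
  for N :: "('a::real_vector \<Rightarrow> real) set" +
  fixes K :: "'a set" and G :: "('a \<Rightarrow> 'a) set"
  assumes K_compact: "compactin weak K" and K_nonempty: "K \<noteq> {}"
    and G_countable: "countable G" and G_nonempty: "G \<noteq> {}"
    and cont: "g \<in> G \<Longrightarrow> continuous_map (subtopology weak K) (subtopology weak K) g"
    and comp: "g \<in> G \<Longrightarrow> h \<in> G \<Longrightarrow> \<exists>k\<in>G. \<forall>x\<in>K. k x = g (h x)"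
    and nonexp: "g \<in> G \<Longrightarrow> nonexpansive_map_on N K g"
    and distal: "x \<in> K \<Longrightarrow> y \<in> K \<Longrightarrow> x \<noteq> y \<Longrightarrow>
      \<exists>F e. finite F \<and> F \<subseteq> N \<and> 0 < e \<and> (\<forall>g\<in>G. e \<le> psum F (g x - g y))"
    and minimal: "closedin (subtopology weak K) A \<Longrightarrow> A \<noteq> {} \<Longrightarrow> (\<And>g. g \<in> G \<Longrightarrow> g ` A \<subseteq> A) \<Longrightarrow> A = K"
begin

definition T :: "'a topology" where "T = subtopology weak K"

lemma topspace_T [simp]: "topspace T = K"
  by (simp add: T_def)

lemma compact_T: "compact_space T"
  using K_compact by (simp add: T_def compact_space_subtopology)

lemma Hausdorff_T: "Hausdorff_space T"
  unfolding T_def by (intro Hausdorff_space_subtopology Hausdorff_weak)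

lemma cont_T: "g \<in> G \<Longrightarrow> continuous_map T T g"
  using cont by (simp add: T_def)

lemma act_in_K: "g \<in> G \<Longrightarrow> x \<in> K \<Longrightarrow> g x \<in> K"
  using continuous_map_image_subset_topspace[OF cont_T] by auto

lemma orbit_dense:
  assumes x: "x \<in> K"
  shows "T closure_of ((\<lambda>g. g x) ` G) = K"
proof (rule minimal[folded T_def])
  let ?O = "(\<lambda>g. g x) ` G"
  have "?O \<subseteq> T closure_of ?O"
    using x act_in_K by (intro closure_of_subset) auto
  then show "T closure_of ?O \<noteq> {}" using G_nonempty by blast
  fix g assume g: "g \<in> G"
  have "g ` (T closure_of ?O) \<subseteq> T closure_of (g ` ?O)"
    using cont_T[OF g] by (rule continuous_map_image_closure_subset)
  also have "\<dots> \<subseteq> T closure_of ?O"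
  proof (rule closure_of_mono)
    show "g ` ?O \<subseteq> ?O"
    proof
      fix z assume "z \<in> g ` ?O"
      then obtain h where h: "h \<in> G" "z = g (h x)" by auto
      obtain k where "k \<in> G" "\<forall>x\<in>K. k x = g (h x)" using comp[OF g h(1)] by blast
      then show "z \<in> ?O" using h x by (metis imageI)
    qed
  qed
  finally show "g ` (T closure_of ?O) \<subseteq> T closure_of ?O" .
qed simp

lemma visits:
  assumes "openin T U" "U \<noteq> {}" "z \<in> K"
  obtains g where "g \<in> G" "g z \<in> U"
proof -
  obtain u where u: "u \<in> U" using assms by blast
  then have "u \<in> T closure_of ((\<lambda>g. g z) ` G)"
    using orbit_dense[OF assms(3)] openin_subset[OF assms(1)] by auto
  then show ?thesis using u assms(1) that unfolding in_closure_of by blast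
qed

lemma fragment:
  assumes "finite F" "F \<subseteq> N" "0 < e"
  obtains U where "openin T U" "U \<noteq> {}"
    "\<And>x y. x \<in> U \<Longrightarrow> y \<in> U \<Longrightarrow> psum F (x - y) < e"
proof -
  obtain x where x: "x \<in> K" using K_nonempty by blast
  have "countable ((\<lambda>g. g x) ` G)" using G_countable by (rule countable_image)
  moreover have "K \<subseteq> weak closure_of ((\<lambda>g. g x) ` G)"
    using orbit_dense[OF x] closure_of_subtopology_subset[of weak K "(\<lambda>g. g x) ` G"] by (simp add: T_def)
  ultimately show ?thesis
    using weakly_compact_fragment[OF assms(1,2) K_compact K_nonempty _ _ assms(3)] that
    unfolding T_def by metis
qed

text \<open>
  Weak proximality implies proximality for the seminorms: some \<open>t\<close> moves the common limit \<open>z\<close> into a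
  small open set, and by weak continuity it moves both \<open>g x\<close> and \<open>g y\<close> there once these are close to \<open>z\<close>.
\<close>
lemma proximal_imp_eq:
  assumes x: "x \<in> K" and y: "y \<in> K" and z: "z \<in> K"
    and proximal: "\<And>U. openin T U \<Longrightarrow> z \<in> U \<Longrightarrow> \<exists>g\<in>G. g x \<in> U \<and> g y \<in> U"
  shows "x = y"
proof (rule ccontr)
  assume "x \<noteq> y"
  then obtain F e where F: "finite F" "F \<subseteq> N" "0 < e" "\<forall>g\<in>G. e \<le> psum F (g x - g y)"
    using distal[OF x y] by metis
  obtain U where U: "openin T U" "U \<noteq> {}" "\<And>x y. x \<in> U \<Longrightarrow> y \<in> U \<Longrightarrow> psum F (x - y) < e"
    using fragment[OF F(1-3)] by blast
  obtain t where t: "t \<in> G" "t z \<in> U" using visits[OF U(1,2) z] by blast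
  have "openin T {w \<in> topspace T. t w \<in> U}"
    using cont_T[OF t(1)] U(1) by (rule openin_continuous_map_preimage)
  then obtain g where g: "g \<in> G" "t (g x) \<in> U" "t (g y) \<in> U"
    using proximal[of "{w \<in> topspace T. t w \<in> U}"] t z by auto
  obtain k where k: "k \<in> G" "\<forall>x\<in>K. k x = t (g x)" using comp[OF t(1) g(1)] by blast
  then have "e \<le> psum F (t (g x) - t (g y))" using F(4) x y by force
  with U(3)[OF g(2,3)] show False by simp
qed

definition self_maps :: "('a \<Rightarrow> 'a) topology" where
  "self_maps = product_topology (\<lambda>_. T) K"

text \<open>The Ellis semigroup of the system.\<close>
definition enveloping :: "('a \<Rightarrow> 'a) set" where
  "enveloping = self_maps closure_of ((\<lambda>g. restrict g K) ` G)"

lemma topspace_self_maps [simp]: "topspace self_maps = (\<Pi>\<^sub>E x\<in>K. K)"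
  by (simp add: self_maps_def)

lemma compact_self_maps: "compact_space self_maps"
  unfolding self_maps_def compact_space_product_topology using compact_T by blast

lemma Hausdorff_self_maps: "Hausdorff_space self_maps"
  unfolding self_maps_def Hausdorff_space_product_topology using Hausdorff_T by blast

lemma eval_continuous: "x \<in> K \<Longrightarrow> continuous_map self_maps T (\<lambda>h. h x)"
  unfolding self_maps_def by (rule continuous_map_product_projection)

lemma closedin_enveloping: "closedin self_maps enveloping"
  by (simp add: enveloping_def)

lemma restrict_mem: "g \<in> G \<Longrightarrow> restrict g K \<in> enveloping"
  unfolding enveloping_def
  by (rule subsetD[OF closure_of_subset]) (auto simp: act_in_K)

lemma enveloping_subset: "enveloping \<subseteq> (\<Pi>\<^sub>E x\<in>K. K)"
  using closedin_subset[OF closedin_enveloping] by simp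

lemma enveloping_maps: "a \<in> enveloping \<Longrightarrow> x \<in> K \<Longrightarrow> a x \<in> K"
  using enveloping_subset by (auto dest!: subsetD)

lemma compose_continuous_left:
  assumes "b \<in> (\<Pi>\<^sub>E x\<in>K. K)"
  shows "continuous_map self_maps self_maps (\<lambda>h. compose K h b)"
  unfolding self_maps_def using assms by (rule continuous_map_compose_left)

lemma compose_continuous_right:
  assumes "g \<in> G"
  shows "continuous_map self_maps self_maps (\<lambda>h. compose K g h)"
proof -
  have "continuous_map self_maps T (\<lambda>h. compose K g h x)" if "x \<in> K" for x
    using that continuous_map_compose[OF eval_continuous[OF that] cont_T[OF assms]]
    by (simp add: compose_def o_def)
  then show ?thesis
    by (subst (2) self_maps_def) (auto simp: continuous_map_componentwise)
qed

lemma enveloping_compose_aux: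
  assumes g: "g \<in> G" and b: "b \<in> enveloping"
  shows "compose K g b \<in> enveloping"
proof -
  let ?R = "(\<lambda>g. restrict g K) ` G"
  have "(\<lambda>h. compose K g h) ` ?R \<subseteq> ?R"
  proof
    fix a assume "a \<in> (\<lambda>h. compose K g h) ` ?R"
    then obtain h where h: "h \<in> G" "a = compose K g (restrict h K)" by auto
    obtain k where k: "k \<in> G" "\<forall>x\<in>K. k x = g (h x)" using comp[OF g h(1)] by blast
    then have "a = restrict k K" using h by (auto simp: compose_def restrict_def)
    then show "a \<in> ?R" using k by blast
  qed
  then have "(\<lambda>h. compose K g h) ` enveloping \<subseteq> enveloping"
    unfolding enveloping_def
    using continuous_map_image_closure_subset[OF compose_continuous_right[OF g]] closure_of_mono
    by (metis (no_types, lifting) subset_trans)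
  then show ?thesis using b by blast
qed

text \<open>
  Composition is continuous in its left argument, whatever the right one is. Continuity in the right
  argument requires the left factor to be weakly continuous, as the members of \<open>G\<close> are; limits of such
  members may fail to be. The closure is therefore taken in the right argument first.
\<close>
lemma enveloping_compose:
  assumes a: "a \<in> enveloping" and b: "b \<in> enveloping"
  shows "compose K a b \<in> enveloping"
proof -
  let ?A = "{h \<in> topspace self_maps. compose K h b \<in> enveloping}"
  have b': "b \<in> (\<Pi>\<^sub>E x\<in>K. K)" using b enveloping_subset by blast
  have "closedin self_maps ?A"
    using compose_continuous_left[OF b'] closedin_enveloping by (rule closedin_continuous_map_preimage)
  moreover have "restrict g K \<in> ?A" if g: "g \<in> G" for g
  proof -
    have "compose K (restrict g K) b = compose K g b"
      using enveloping_maps[OF b] by (auto simp: compose_def restrict_def fun_eq_iff)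
    then show ?thesis using enveloping_compose_aux[OF g b] g act_in_K by auto
  qed
  ultimately have "enveloping \<subseteq> ?A"
    unfolding enveloping_def by (intro closure_of_minimal image_subsetI)
  then show ?thesis using a by blast
qed

lemma enveloping_nonexpansive:
  assumes a: "a \<in> enveloping" and p: "p \<in> N" and x: "x \<in> K" and y: "y \<in> K"
  shows "p (a x - a y) \<le> p (x - y)"
proof -
  let ?A = "{h \<in> topspace self_maps. psum {p} (h x - h y) \<le> p (x - y)}"
  have "closedin self_maps ?A"
    using p eval_continuous[OF x] eval_continuous[OF y]
    by (intro closedin_psum_le) (auto simp: T_def intro: continuous_map_into_fulltopology)
  moreover have "restrict g K \<in> ?A" if g: "g \<in> G" for g
    using nonexp[OF g] p x y act_in_K[OF g] by (auto simp: nonexpansive_map_on_def)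
  ultimately have "enveloping \<subseteq> ?A"
    unfolding enveloping_def by (intro closure_of_minimal image_subsetI)
  then show ?thesis using a by auto
qed

text \<open>An idempotent \<open>e\<close> maps \<open>x\<close> and \<open>e x\<close> to the same point, so these two points are proximal.\<close>
lemma enveloping_idempotent:
  assumes e: "e \<in> enveloping" "compose K e e = e" and x: "x \<in> K"
  shows "e x = x"
proof -
  have ex: "e x \<in> K" using e x by (simp add: enveloping_maps)
  have eex: "e (e x) = e x" using e(2) x by (metis compose_eq)
  have "x = e x"
  proof (rule proximal_imp_eq[OF x ex ex])
    fix U assume U: "openin T U" "e x \<in> U"
    let ?V = "{h \<in> topspace self_maps. h x \<in> U} \<inter> {h \<in> topspace self_maps. h (e x) \<in> U}"
    have V: "openin self_maps ?V"
      using eval_continuous[OF x] eval_continuous[OF ex] U(1)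
      by (intro openin_Int openin_continuous_map_preimage)
    have eV: "e \<in> ?V" using e(1) enveloping_subset eex U by auto
    have "\<exists>h. h \<in> (\<lambda>g. restrict g K) ` G \<and> h \<in> ?V"
      using e(1)[unfolded enveloping_def in_closure_of, THEN conjunct2, rule_format, OF conjI[OF eV V]] .
    then show "\<exists>g\<in>G. g x \<in> U \<and> g (e x) \<in> U" using x ex by auto
  qed
  then show ?thesis by simp
qed

text \<open>
  The translate of the Ellis semigroup by \<open>a\<close> is again a compact semigroup. It contains an idempotent
  \<open>b \<circ> a\<close>, and that idempotent is the identity.
\<close>
lemma enveloping_left_inverse:
  assumes a: "a \<in> enveloping"
  obtains b where "b \<in> enveloping" "\<And>x. x \<in> K \<Longrightarrow> b (a x) = x"
proof -
  let ?E = "(\<lambda>b. compose K b a) ` enveloping"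
  have PiE: "c \<in> (\<Pi>\<^sub>E x\<in>K. K)" if "c \<in> enveloping" for c using that enveloping_subset by blast
  have assoc: "compose K (compose K b c) d = compose K b (compose K c d)"
    if "b \<in> enveloping" "c \<in> enveloping" "d \<in> enveloping" for b c d
    using that enveloping_maps by (auto simp: compose_def restrict_def fun_eq_iff)
  have sub: "?E \<subseteq> enveloping" using a enveloping_compose by blast
  have "compactin self_maps enveloping"
    using closedin_enveloping compact_self_maps closedin_compact_space by blast
  then have "closedin self_maps ?E"
    using compose_continuous_left[OF PiE[OF a]] Hausdorff_self_maps
    by (meson compactin_imp_closedin image_compactin)
  moreover have "?E \<noteq> {}" using a by blast
  moreover have "compose K b c \<in> ?E" if "b \<in> ?E" "c \<in> ?E" for b c
  proof -
    obtain c' where c': "c' \<in> enveloping" "c = compose K c' a" using \<open>c \<in> ?E\<close> by auto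
    have "b \<in> enveloping" using \<open>b \<in> ?E\<close> sub by blast
    then have "compose K b c = compose K (compose K b c') a" "compose K b c' \<in> enveloping"
      using assoc[OF _ c'(1) a] enveloping_compose[OF _ c'(1)] c'(2) by auto
    then show ?thesis by simp
  qed
  moreover have "compose K (compose K b c) d = compose K b (compose K c d)"
    if "b \<in> ?E" "c \<in> ?E" "d \<in> ?E" for b c d
    using that sub by (intro assoc) auto
  moreover have "continuous_map self_maps self_maps (\<lambda>c. compose K c b)" if "b \<in> ?E" for b
    using that sub by (intro compose_continuous_left PiE) auto
  ultimately obtain e where e: "e \<in> ?E" "compose K e e = e"
    by (rule right_topological_semigroup_idempotent[OF compact_self_maps Hausdorff_self_maps, of ?E "compose K"])
  then obtain b where b: "b \<in> enveloping" "e = compose K b a" by auto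
  have "b (a x) = x" if "x \<in> K" for x
    using enveloping_idempotent[OF _ e(2) that] e(1) sub b(2) that by (auto simp: compose_eq)
  then show ?thesis using that b by blast
qed

lemma surjective_isometry:
  assumes g: "g \<in> G"
  shows "g ` K = K" "p \<in> N \<Longrightarrow> x \<in> K \<Longrightarrow> y \<in> K \<Longrightarrow> p (g x - g y) = p (x - y)"
proof -
  obtain b where b: "b \<in> enveloping" "\<And>x. x \<in> K \<Longrightarrow> b (restrict g K x) = x"
    using enveloping_left_inverse[OF restrict_mem[OF g]] by blast
  obtain c where c: "c \<in> enveloping" "\<And>x. x \<in> K \<Longrightarrow> c (b x) = x"
    using enveloping_left_inverse[OF b(1)] by blast
  have bg: "b (g x) = x" if "x \<in> K" for x using b(2)[OF that] that by simp
  \<comment> \<open>A left inverse \<open>c\<close> of the left inverse \<open>b\<close> of \<open>g\<close> agrees with \<open>g\<close>, so \<open>b\<close> is a two-sided inverse.\<close>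
  have "g (b x) = x" if x: "x \<in> K" for x
  proof -
    have bx: "b x \<in> K" using b(1) x by (rule enveloping_maps)
    have "g (b x) = c (b (g (b x)))" using c(2)[OF act_in_K[OF g bx]] by simp
    then show ?thesis using bg[OF bx] c(2)[OF x] by simp
  qed
  then have "x \<in> g ` K" if "x \<in> K" for x
    using that enveloping_maps[OF b(1) that] by (metis imageI)
  then show "g ` K = K" using act_in_K[OF g] by auto
  assume p: "p \<in> N" and x: "x \<in> K" and y: "y \<in> K"
  show "p (g x - g y) = p (x - y)"
  proof (rule antisym)
    show "p (g x - g y) \<le> p (x - y)" using nonexp[OF g] p x y by (auto simp: nonexpansive_map_on_def)
    show "p (x - y) \<le> p (g x - g y)"
      using enveloping_nonexpansive[OF b(1) p act_in_K[OF g x] act_in_K[OF g y]] by (simp add: bg x y)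
  qed
qed

text \<open>
  The preimages under \<open>G\<close> of a small open set cover \<open>K\<close> by minimality, and they are as small as that set
  because \<open>G\<close> acts by isometries.
\<close>
lemma totally_bounded:
  assumes p: "p \<in> N" and e: "0 < e"
  obtains \<V> where "finite \<V>" "K \<subseteq> \<Union>\<V>" "\<And>V x y. V \<in> \<V> \<Longrightarrow> x \<in> V \<Longrightarrow> y \<in> V \<Longrightarrow> p (x - y) < e"
proof -
  obtain U where U: "openin T U" "U \<noteq> {}" "\<And>x y. x \<in> U \<Longrightarrow> y \<in> U \<Longrightarrow> p (x - y) < e"
    using fragment[of "{p}" e] p e by auto
  define V where "V g = {x \<in> topspace T. g x \<in> U}" for g
  have "openin T (V g)" if "g \<in> G" for g
    unfolding V_def using cont_T[OF that] U(1) by (rule openin_continuous_map_preimage)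
  moreover have "topspace T \<subseteq> \<Union>(V ` G)"
  proof
    fix x assume "x \<in> topspace T"
    then show "x \<in> \<Union>(V ` G)" using visits[OF U(1,2), of x] by (auto simp: V_def)
  qed
  ultimately obtain \<V> where \<V>: "finite \<V>" "\<V> \<subseteq> V ` G" "topspace T \<subseteq> \<Union>\<V>"
    using compactinD[OF compact_T[unfolded compact_space_def], of "V ` G"] by auto
  have "p (x - y) < e" if "W \<in> \<V>" "x \<in> W" "y \<in> W" for W x y
  proof -
    obtain g where g: "g \<in> G" "W = V g" using \<open>W \<in> \<V>\<close> \<V>(2) by auto
    then have "p (g x - g y) < e" using U(3) that by (auto simp: V_def)
    then show ?thesis using surjective_isometry(2)[OF g(1) p, of x y] g that by (simp add: V_def)
  qed
  then show ?thesis using that[of \<V>] \<V> by simp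
qed

end

section \<open>Nondiametral points of totally bounded sets\<close>

text \<open>
  An \<open>e\<close>-separated set has at most one point in each member of the cover; one of
  maximal cardinality is a net.
\<close>

lemma separated_net:
  assumes p: "seminorm p" and e: "0 < e"
    and \<V>: "finite \<V>" "K \<subseteq> \<Union>\<V>" "\<And>V x y. V \<in> \<V> \<Longrightarrow> x \<in> V \<Longrightarrow> y \<in> V \<Longrightarrow> p (x - y) < e"
  obtains A where "finite A" "A \<subseteq> K" "\<And>a b. a \<in> A \<Longrightarrow> b \<in> A \<Longrightarrow> a \<noteq> b \<Longrightarrow> e \<le> p (a - b)"
    "\<And>y. y \<in> K \<Longrightarrow> \<exists>a\<in>A. p (a - y) < e"
proof -
  define P where "P A \<longleftrightarrow> finite A \<and> A \<subseteq> K \<and> (\<forall>a\<in>A. \<forall>b\<in>A. a \<noteq> b \<longrightarrow> e \<le> p (a - b))" for A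
  have "card A \<le> card \<V>" if A: "P A" for A
  proof -
    have "\<forall>a\<in>A. \<exists>V\<in>\<V>. a \<in> V" using A \<V>(2) by (auto simp: P_def)
    then obtain v where v: "\<And>a. a \<in> A \<Longrightarrow> v a \<in> \<V> \<and> a \<in> v a" by metis
    have "inj_on v A"
    proof (rule inj_onI, rule ccontr)
      fix a b assume ab: "a \<in> A" "b \<in> A" "v a = v b" "a \<noteq> b"
      then have "p (a - b) < e" using \<V>(3)[of "v a" a b] v[of a] v[of b] by auto
      then show False using A ab by (force simp: P_def)
    qed
    then show ?thesis using v \<V>(1) by (intro card_inj_on_le[of v]) auto
  qed
  moreover have "P {}" by (simp add: P_def)
  ultimately have "\<exists>A. P A \<and> (\<forall>B. P B \<longrightarrow> card B \<le> card A)"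
    by (intro ex_has_greatest_nat[of P "{}" card "Suc (card \<V>)"]) (auto simp: less_Suc_eq_le)
  then obtain A where A: "P A" "\<And>B. P B \<Longrightarrow> card B \<le> card A" by metis
  have "\<exists>a\<in>A. p (a - y) < e" if y: "y \<in> K" for y
  proof (rule ccontr)
    assume "\<not> ?thesis"
    then have far: "e \<le> p (a - y)" if "a \<in> A" for a using that by force
    have "y \<notin> A" using far[of y] e seminorm_0[OF p] by auto
    moreover have "P (insert y A)"
      using A(1) y far seminorm_diff_commute[OF p, of y] by (auto simp: P_def)
    ultimately show False using A(2)[of "insert y A"] A(1) by (simp add: P_def)
  qed
  then show ?thesis using A(1) unfolding P_def by (intro that[of A]) auto
qed

text \<open>
  DeMarr's argument. With \<open>d\<close> the diameter of \<open>K\<close>, let \<open>u\<close> be the mean of a \<open>d/2\<close>-net with \<open>m\<close> points.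
  Each \<open>z\<close> in \<open>K\<close> is within \<open>d/2\<close> of one point of the net and within \<open>d\<close> of the others, which gives
  \<open>p (u - z) \<le> d - d / (2 m)\<close>.
\<close>
lemma nondiametral_point:
  assumes p: "seminorm p" and xy: "x \<in> K" "y \<in> K" "0 < p (x - y)"
    and tb: "\<And>e. 0 < e \<Longrightarrow> \<exists>\<V>. finite \<V> \<and> K \<subseteq> \<Union>\<V> \<and> (\<forall>V\<in>\<V>. \<forall>x\<in>V. \<forall>y\<in>V. p (x - y) < e)"
  obtains u r a b where "u \<in> convex hull K" "\<And>z. z \<in> K \<Longrightarrow> p (u - z) \<le> r"
    "a \<in> K" "b \<in> K" "r < p (a - b)"
proof -
  define D where "D = (\<lambda>(a, b). p (a - b)) ` (K \<times> K)"
  define d where "d = Sup D"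
  obtain \<V> where "finite \<V>" "K \<subseteq> \<Union>\<V>" "\<forall>V\<in>\<V>. \<forall>x\<in>V. \<forall>y\<in>V. p (x - y) < 1"
    using tb[of 1] by auto
  then obtain A where A: "finite A" "\<And>y. y \<in> K \<Longrightarrow> \<exists>a\<in>A. p (a - y) < 1"
    using separated_net[OF p, of 1 \<V> K] by (metis zero_less_one)
  \<comment> \<open>A net for the radius 1 shows that the diameter is finite.\<close>
  define c where "c = Max ((\<lambda>(a, b). p (a - b)) ` (A \<times> A))"
  have "t \<le> c + 2" if "t \<in> D" for t
  proof -
    obtain a b where ab: "a \<in> K" "b \<in> K" "t = p (a - b)" using \<open>t \<in> D\<close> by (auto simp: D_def)
    obtain a' b' where ab': "a' \<in> A" "p (a' - a) < 1" "b' \<in> A" "p (b' - b) < 1"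
      using A(2) ab by metis
    have "p (a' - b') \<le> c" unfolding c_def using A(1) ab' by (intro Max_ge) auto
    moreover have "t \<le> p (a - a') + p (a' - b') + p (b' - b)"
      unfolding ab(3) using seminorm_diff_triangle[OF p, of a b a'] seminorm_diff_triangle[OF p, of a' b b'] by simp
    ultimately show ?thesis using ab' seminorm_diff_commute[OF p, of a a'] by simp
  qed
  then have bdd: "bdd_above D" by (auto simp: bdd_above_def)
  have le_d: "p (a - b) \<le> d" if "a \<in> K" "b \<in> K" for a b
    unfolding d_def using that bdd by (intro cSup_upper) (auto simp: D_def)
  have d: "0 < d" using le_d[of x y] xy by simp
  obtain \<V> where "finite \<V>" "K \<subseteq> \<Union>\<V>" "\<forall>V\<in>\<V>. \<forall>x\<in>V. \<forall>y\<in>V. p (x - y) < d / 2"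
    using tb[of "d / 2"] d by auto
  then obtain B where B: "finite B" "B \<subseteq> K" "\<And>y. y \<in> K \<Longrightarrow> \<exists>b\<in>B. p (b - y) < d / 2"
    using separated_net[OF p, of "d / 2" \<V> K] d by (metis half_gt_zero)
  define m where "m = real (card B)"
  have "B \<noteq> {}" using B(3) xy by blast
  then have m: "0 < m" using B(1) by (simp add: m_def card_gt_0_iff)
  define u where "u = (\<Sum>b\<in>B. (1 / m) *\<^sub>R b)"
  have "u \<in> convex hull K"
    unfolding u_def using B m hull_subset[of K convex]
    by (intro convex_sum) (auto simp: m_def)
  moreover have "p (u - z) \<le> d - d / (2 * m)" if z: "z \<in> K" for z
  proof -
    obtain b0 where b0: "b0 \<in> B" "p (b0 - z) < d / 2" using B(3) z by blast
    have "u - z = (\<Sum>b\<in>B. (1 / m) *\<^sub>R (b - z))"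
      using m by (simp add: u_def scaleR_diff_right sum_subtractf sum_constant_scaleR m_def)
    then have "p (u - z) \<le> (\<Sum>b\<in>B. p ((1 / m) *\<^sub>R (b - z)))"
      using seminorm_sum_le[OF p B(1)] by simp
    also have "\<dots> = (\<Sum>b\<in>B. p (b - z)) / m"
      using m by (simp add: seminorm_scaleR[OF p] sum_divide_distrib)
    also have "(\<Sum>b\<in>B. p (b - z)) = p (b0 - z) + (\<Sum>b\<in>B - {b0}. p (b - z))"
      using B(1) b0(1) by (rule sum.remove)
    also have "(\<Sum>b\<in>B - {b0}. p (b - z)) \<le> (m - 1) * d"
    proof -
      have "(\<Sum>b\<in>B - {b0}. p (b - z)) \<le> real (card (B - {b0})) * d"
        using B z by (intro sum_bounded_above le_d) auto
      then show ?thesis using B(1) b0(1) \<open>B \<noteq> {}\<close> m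
        by (simp add: m_def card_Diff_singleton of_nat_diff Suc_le_eq card_gt_0_iff)
    qed
    also have "(p (b0 - z) + (m - 1) * d) / m \<le> (d / 2 + (m - 1) * d) / m"
      using b0(2) m by (intro divide_right_mono) auto
    also have "\<dots> = d - d / (2 * m)" using m by (simp add: field_simps)
    finally show ?thesis using m by (simp add: divide_right_mono)
  qed
  moreover have "d - d / (2 * m) < d" using d m by simp
  then obtain t where "t \<in> D" "d - d / (2 * m) < t"
    using less_cSup_iff[OF _ bdd, of "d - d / (2 * m)"] xy(1) unfolding d_def[symmetric]
    by (auto simp: D_def)
  then obtain a b where "a \<in> K" "b \<in> K" "d - d / (2 * m) < p (a - b)" by (auto simp: D_def)
  ultimately show ?thesis using that by blast
qed

section \<open>Common fixed points\<close>

lemma continuous_map_restrict_invariant: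
  assumes "continuous_map (subtopology X Q) (subtopology X Q) g" "A \<subseteq> Q" "g ` A \<subseteq> A"
  shows "continuous_map (subtopology X A) (subtopology X A) g"
  using assms continuous_map_from_subtopology_mono[OF assms(1,2)]
  by (auto simp: continuous_map_in_subtopology)

context separating_seminorms
begin

text \<open>
  Two minimal sets are needed. The nondiametral point lies in the convex hull of \<open>K\<close>, so the contradiction is with
  minimality among convex sets; but only minimality among all closed invariant sets makes every
  orbit dense in \<open>K\<close>, which the isometry argument rests on.
\<close>
lemma countable_common_fixed_point:
  assumes Q: "compactin weak Q" "Q \<noteq> {}" "convex Q"
    and G: "countable G" "G \<noteq> {}"
    and cont: "\<And>g. g \<in> G \<Longrightarrow> continuous_map (subtopology weak Q) (subtopology weak Q) g"
    and comp: "\<And>g h. g \<in> G \<Longrightarrow> h \<in> G \<Longrightarrow> \<exists>k\<in>G. \<forall>x\<in>Q. k x = g (h x)"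
    and nonexp: "\<And>g. g \<in> G \<Longrightarrow> nonexpansive_map_on N Q g"
    and distal: "\<And>x y. x \<in> Q \<Longrightarrow> y \<in> Q \<Longrightarrow> x \<noteq> y \<Longrightarrow>
      \<exists>F e. finite F \<and> F \<subseteq> N \<and> 0 < e \<and> (\<forall>g\<in>G. e \<le> psum F (g x - g y))"
  obtains x where "x \<in> Q" "\<forall>g\<in>G. g x = x"
proof -
  define T where "T = subtopology weak Q"
  have T: "compact_space T" "topspace T = Q" using Q by (auto simp: T_def compact_space_subtopology)
  have maps: "g ` Q \<subseteq> Q" if "g \<in> G" for g
    using continuous_map_image_subset_topspace[OF cont[OF that]] by simp
  obtain C where C': "closedin T C" "C \<noteq> {}" "convex C \<and> (\<forall>g\<in>G. g ` C \<subseteq> C)"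
    and C_min': "\<And>B. closedin T B \<Longrightarrow> B \<noteq> {} \<Longrightarrow> convex B \<and> (\<forall>g\<in>G. g ` B \<subseteq> B) \<Longrightarrow> B \<subseteq> C \<Longrightarrow> B = C"
  proof (rule minimal_closed_subset[of T Q "\<lambda>B. convex B \<and> (\<forall>g\<in>G. g ` B \<subseteq> B)"])
    show "convex (\<Inter>\<C>) \<and> (\<forall>g\<in>G. g ` \<Inter>\<C> \<subseteq> \<Inter>\<C>)"
      if "\<And>B. B \<in> \<C> \<Longrightarrow> convex B \<and> (\<forall>g\<in>G. g ` B \<subseteq> B)" for \<C>
      using that by (auto simp: image_subset_iff intro!: convex_Inter)
    show "closedin T Q" using closedin_topspace[of T] T(2) by simp
    show "convex Q \<and> (\<forall>g\<in>G. g ` Q \<subseteq> Q)" using Q(3) maps by blast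
    show "compact_space T" "Q \<noteq> {}" by fact+
  qed (rule that)
  then have C: "closedin T C" "C \<noteq> {}" "convex C" "\<And>g. g \<in> G \<Longrightarrow> g ` C \<subseteq> C" by auto
  have C_min: "B = C" if "closedin T B" "B \<noteq> {}" "convex B" "\<And>g. g \<in> G \<Longrightarrow> g ` B \<subseteq> B" "B \<subseteq> C" for B
    using that by (intro C_min') auto
  obtain K where K': "closedin T K" "K \<noteq> {}" "\<forall>g\<in>G. g ` K \<subseteq> K" "K \<subseteq> C"
    and K_min': "\<And>B. closedin T B \<Longrightarrow> B \<noteq> {} \<Longrightarrow> \<forall>g\<in>G. g ` B \<subseteq> B \<Longrightarrow> B \<subseteq> K \<Longrightarrow> B = K"
  proof (rule minimal_closed_subset[of T C "\<lambda>B. \<forall>g\<in>G. g ` B \<subseteq> B"])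
    show "\<forall>g\<in>G. g ` \<Inter>\<C> \<subseteq> \<Inter>\<C>" if "\<And>B. B \<in> \<C> \<Longrightarrow> \<forall>g\<in>G. g ` B \<subseteq> B" for \<C>
      using that by (simp add: image_subset_iff)
    show "\<forall>g\<in>G. g ` C \<subseteq> C" using C(4) by blast
    show "compact_space T" "closedin T C" "C \<noteq> {}" by fact+
  qed (rule that)
  then have K: "closedin T K" "K \<noteq> {}" "\<And>g. g \<in> G \<Longrightarrow> g ` K \<subseteq> K" "K \<subseteq> C" by auto
  have K_min: "B = K" if "closedin T B" "B \<noteq> {}" "\<And>g. g \<in> G \<Longrightarrow> g ` B \<subseteq> B" "B \<subseteq> K" for B
    using that by (intro K_min') auto
  have CQ: "C \<subseteq> Q" using closedin_subset[OF C(1)] T by simp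
  have KQ: "K \<subseteq> Q" using K(4) CQ by blast
  interpret min: minimal_distal_system N K G
  proof
    have "compactin T K" using K(1) T(1) closedin_compact_space by blast
    then show "compactin weak K" by (simp add: T_def compactin_subtopology)
    show "continuous_map (subtopology weak K) (subtopology weak K) g" if "g \<in> G" for g
      using cont[OF that] KQ K(3)[OF that] by (rule continuous_map_restrict_invariant)
    show "\<exists>k\<in>G. \<forall>x\<in>K. k x = g (h x)" if "g \<in> G" "h \<in> G" for g h
      using comp[OF that] KQ by blast
    show "nonexpansive_map_on N K g" if "g \<in> G" for g
      using nonexp[OF that] KQ by (auto simp: nonexpansive_map_on_def)
    show "A = K" if A: "closedin (subtopology weak K) A" "A \<noteq> {}" "\<And>g. g \<in> G \<Longrightarrow> g ` A \<subseteq> A" for A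
    proof (rule K_min)
      have "closedin (subtopology T K) A"
        using A(1) KQ by (simp add: T_def subtopology_subtopology Int_absorb1)
      then show "closedin T A" using K(1) by (rule closedin_trans_full)
      show "A \<subseteq> K" using closedin_subset[OF A(1)] by simp
    qed (use A in auto)
    show "\<exists>F e. finite F \<and> F \<subseteq> N \<and> 0 < e \<and> (\<forall>g\<in>G. e \<le> psum F (g x - g y))"
      if "x \<in> K" "y \<in> K" "x \<noteq> y" for x y
      using that KQ by (intro distal) auto
    show "K \<noteq> {}" "countable G" "G \<noteq> {}" by fact+
  qed
  have single: "x = y" if x: "x \<in> K" and y: "y \<in> K" for x y
  proof (rule ccontr)
    assume "x \<noteq> y"
    then obtain p where p: "p \<in> N" "p (x - y) \<noteq> 0" using separating[of "x - y"] by auto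
    note sp = seminorm_N[OF p(1)]
    have pos: "0 < p (x - y)" using p(2) seminorm_nonneg[OF sp, of "x - y"] by simp
    have "\<exists>\<V>. finite \<V> \<and> K \<subseteq> \<Union>\<V> \<and> (\<forall>V\<in>\<V>. \<forall>x\<in>V. \<forall>y\<in>V. p (x - y) < e)" if "0 < e" for e
      using min.totally_bounded[OF p(1) that] by metis
    then obtain u r a b where u: "u \<in> convex hull K" "\<And>z. z \<in> K \<Longrightarrow> p (u - z) \<le> r"
      and ab: "a \<in> K" "b \<in> K" "r < p (a - b)"
      using nondiametral_point[OF sp x y pos] by metis
    \<comment> \<open>\<open>B\<close> contains \<open>u\<close>. By minimality of \<open>C\<close> it is all of \<open>C\<close>, so it contains \<open>a\<close>, which is too far
      from \<open>b\<close>.\<close>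
    define B where "B = {w \<in> C. \<forall>z\<in>K. p (w - z) \<le> r}"
    have "B = C"
    proof (rule C_min)
      have "closedin T {w \<in> topspace T. psum {p} (w - z) \<le> r}" for z
        using p by (intro closedin_psum_le) (auto simp: T_def intro: continuous_map_from_subtopology)
      then have "closedin T (\<Inter>(insert C ((\<lambda>z. {w \<in> topspace T. psum {p} (w - z) \<le> r}) ` K)))"
        using C(1) by (intro closedin_Inter) auto
      moreover have "B = \<Inter>(insert C ((\<lambda>z. {w \<in> topspace T. psum {p} (w - z) \<le> r}) ` K))"
        using CQ T(2) by (auto simp: B_def)
      ultimately show "closedin T B" by simp
      have "convex hull K \<subseteq> C" using K(4) C(3) by (rule hull_minimal)
      then show "B \<noteq> {}" using u by (auto simp: B_def)
      show "convex B"
      proof (rule convexI)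
        fix v w :: 'a and s t :: real
        assume vw: "v \<in> B" "w \<in> B" and st: "0 \<le> s" "0 \<le> t" "s + t = 1"
        have "p (s *\<^sub>R v + t *\<^sub>R w - z) \<le> r" if z: "z \<in> K" for z
        proof -
          have "s *\<^sub>R v + t *\<^sub>R w - z = s *\<^sub>R (v - z) + t *\<^sub>R (w - z)"
            using scaleR_left_distrib[of s t z] st by (simp add: algebra_simps)
          then have "p (s *\<^sub>R v + t *\<^sub>R w - z) \<le> s * p (v - z) + t * p (w - z)"
            using seminorm_triangle[OF sp, of "s *\<^sub>R (v - z)" "t *\<^sub>R (w - z)"] st
            by (simp add: seminorm_scaleR[OF sp])
          also have "\<dots> \<le> s * r + t * r"
            using vw z st by (intro add_mono mult_left_mono) (auto simp: B_def)
          also have "\<dots> = r" using st by (simp add: distrib_right[symmetric])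
          finally show ?thesis .
        qed
        then show "s *\<^sub>R v + t *\<^sub>R w \<in> B"
          using vw st convexD[OF C(3)] by (auto simp: B_def)
      qed
      fix g assume g: "g \<in> G"
      show "g ` B \<subseteq> B"
      proof
        fix w' assume "w' \<in> g ` B"
        then obtain w where w: "w \<in> B" "w' = g w" by blast
        have "p (g w - z) \<le> r" if "z \<in> K" for z
        proof -
          \<comment> \<open>Surjectivity of \<open>g\<close> on \<open>K\<close> is essential: nonexpansiveness alone would not control
            the distance from \<open>g w\<close> to points outside \<open>g ` K\<close>.\<close>
          obtain z' where z': "z' \<in> K" "z = g z'"
            using min.surjective_isometry(1)[OF g] \<open>z \<in> K\<close> by blast
          have "p (g w - g z') \<le> p (w - z')"
            using nonexp[OF g] w z' p subsetD[OF CQ, of w] subsetD[OF KQ, of z'] by (auto simp: nonexpansive_map_on_def B_def)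
          also have "\<dots> \<le> r" using w z' by (auto simp: B_def)
          finally show ?thesis using z' by simp
        qed
        then show "w' \<in> B" using w C(4)[OF g] by (auto simp: B_def)
      qed
    qed (auto simp: B_def)
    then have "a \<in> B" using ab(1) K(4) by blast
    then show False using ab by (auto simp: B_def)
  qed
  obtain x where x: "x \<in> K" using K(2) by blast
  have "g x = x" if "g \<in> G" for g using single[of "g x" x] K(3)[OF that] x by blast
  then show ?thesis using that x KQ by blast
qed

end

lemma countable_subsemigroup:
  fixes A :: "'s::semigroup_mult set"
  assumes "countable A"
  obtains B where "countable B" "A \<subseteq> B" "\<forall>s\<in>B. \<forall>t\<in>B. s * t \<in> B"
proof -
  define X where "X n = ((\<lambda>B. B \<union> (\<lambda>(s, t). s * t) ` (B \<times> B)) ^^ n) A" for n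
  have X_Suc: "X (Suc n) = X n \<union> (\<lambda>(s, t). s * t) ` (X n \<times> X n)" for n by (simp add: X_def)
  have "countable (X n)" for n
  proof (induction n)
    case 0
    then show ?case using assms by (simp add: X_def)
  next
    case (Suc n)
    then show ?case unfolding X_Suc by (intro countable_Un countable_image countable_SIGMA)
  qed
  moreover have mono: "X m \<subseteq> X n" if "m \<le> n" for m n
    by (rule lift_Suc_mono_le[of X, OF _ that]) (simp add: X_Suc)
  have "s * t \<in> (\<Union>n. X n)" if st: "s \<in> (\<Union>n. X n)" "t \<in> (\<Union>n. X n)" for s t
  proof -
    obtain m n where "s \<in> X m" "t \<in> X n" using st by blast
    then have "s \<in> X (max m n)" "t \<in> X (max m n)"
      using mono[of m "max m n"] mono[of n "max m n"] by auto
    then have "s * t \<in> X (Suc (max m n))"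
      using imageI[of "(s, t)" "X (max m n) \<times> X (max m n)" "\<lambda>(s, t). s * t"] by (simp add: X_Suc)
    then show ?thesis by blast
  qed
  moreover have "A \<subseteq> (\<Union>n. X n)" using UN_upper[of 0 UNIV X] by (simp add: X_def)
  ultimately show ?thesis using that[of "\<Union>n. X n"] by simp
qed

locale distal_nonexpansive_action = separating_seminorms N
  for N :: "('a::real_vector \<Rightarrow> real) set" +
  fixes act :: "'s::semigroup_mult \<Rightarrow> 'a \<Rightarrow> 'a" and Q :: "'a set"
  assumes Q_nonempty: "Q \<noteq> {}" and Q_compact: "compactin weak Q" and Q_convex: "convex Q"
    and dynamical: "dynamical_system act (subtopology weak Q)"
    and nonexp: "nonexpansive_action N act Q"
    and distal: "distal_action (seminorm_topology N) act Q"
begin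

lemma act_continuous: "continuous_map (subtopology weak Q) (subtopology weak Q) (act s)"
  using dynamical by (simp add: dynamical_system_def)

lemma act_mult: "x \<in> Q \<Longrightarrow> act (s * t) x = act s (act t x)"
  using dynamical by (simp add: dynamical_system_def)

lemma act_maps: "x \<in> Q \<Longrightarrow> act s x \<in> Q"
  using continuous_map_image_subset_topspace[OF act_continuous] by auto

lemma uniformly_distal:
  assumes "x \<in> Q" "y \<in> Q" "x \<noteq> y"
  shows "\<exists>F e. finite F \<and> F \<subseteq> N \<and> 0 < e \<and> (\<forall>s. e \<le> psum F (act s x - act s y))"
proof -
  have "0 \<notin> seminorm_topology N closure_of {act s x - act s y | s. True}"
    using distal assms by (simp add: distal_action_def)
  then obtain W where W: "openin (seminorm_topology N) W" "0 \<in> W" "\<And>s. act s x - act s y \<notin> W"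
    unfolding in_closure_of by auto
  obtain F e where "finite F" "F \<subseteq> N" "0 < e" "\<And>z. psum F (z - 0) < e \<Longrightarrow> z \<in> W"
    using W(1,2) unfolding openin_seminorm_topology by metis
  then show ?thesis using W(3) by (metis diff_zero not_less)
qed

text \<open>
  The fixed points of one element form a weakly closed set, and finitely many elements have a common
  fixed point because they lie in a countable subsemigroup, so compactness applies.
  The statement allows an arbitrary invariant subset \<open>A\<close> because the construction of the retraction
  applies it to orbits under the maps that fix \<open>F(S)\<close>.
\<close>
lemma common_fixed_point:
  assumes "A \<subseteq> Q" and A: "A \<noteq> {}" "compactin weak A" "convex A" and inv: "\<And>s. act s ` A \<subseteq> A"
  obtains x where "x \<in> A" "\<And>s. act s x = x"
proof -
  define T where "T = subtopology weak A"
  have T: "compact_space T" "topspace T = A" using A by (auto simp: T_def compact_space_subtopology)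
  have cont: "continuous_map T T (act s)" for s
    unfolding T_def using act_continuous \<open>A \<subseteq> Q\<close> inv by (rule continuous_map_restrict_invariant)
  define Fix where "Fix s = {x \<in> A. act s x = x}" for s
  have "closedin T (Fix s)" for s
  proof -
    have "closedin T {x \<in> topspace T. psum {p} (act s x - x) \<le> 0}" if "p \<in> N" for p
      using that cont by (intro closedin_psum_le) (auto simp: T_def intro: continuous_map_into_fulltopology continuous_map_from_subtopology)
    then have "closedin T (\<Inter>(insert (topspace T) ((\<lambda>p. {x \<in> topspace T. psum {p} (act s x - x) \<le> 0}) ` N)))"
      by (intro closedin_Inter) auto
    moreover have "act s x = x \<longleftrightarrow> (\<forall>p\<in>N. p (act s x - x) \<le> 0)" for x
      by (rule eq_iff_seminorms)
    then have "Fix s = \<Inter>(insert (topspace T) ((\<lambda>p. {x \<in> topspace T. psum {p} (act s x - x) \<le> 0}) ` N))"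
      using T(2) by (auto simp: Fix_def)
    ultimately show ?thesis by simp
  qed
  moreover have "\<Inter>\<F> \<noteq> {}" if "finite \<F>" "\<F> \<subseteq> range Fix" for \<F>
  proof -
    obtain S where S: "finite S" "\<F> = Fix ` S" using finite_subset_image[OF \<open>finite \<F>\<close> \<open>\<F> \<subseteq> range Fix\<close>] by blast
    \<comment> \<open>Inserting an arbitrary element makes the subsemigroup nonempty when \<open>S\<close> is empty.\<close>
    have "countable (insert undefined S)" using S(1) by (simp add: countable_finite)
    then obtain B where B: "countable B" "insert undefined S \<subseteq> B" "\<forall>s\<in>B. \<forall>t\<in>B. s * t \<in> B"
      by (rule countable_subsemigroup)
    have comp: "\<exists>k\<in>act ` B. \<forall>x\<in>A. k x = g (h x)" if "g \<in> act ` B" "h \<in> act ` B" for g h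
    proof -
      obtain s t where st: "s \<in> B" "g = act s" "t \<in> B" "h = act t" using \<open>g \<in> act ` B\<close> \<open>h \<in> act ` B\<close> by blast
      have "\<forall>x\<in>A. act (s * t) x = g (h x)" using st act_mult \<open>A \<subseteq> Q\<close> by blast
      then show ?thesis using B(3) st(1,3) by blast
    qed
    have nonexp: "nonexpansive_map_on N A g" if "g \<in> act ` B" for g
      using that nonexp \<open>A \<subseteq> Q\<close> by (auto simp: nonexpansive_action_def nonexpansive_map_on_def subset_iff)
    have distal: "\<exists>F e. finite F \<and> F \<subseteq> N \<and> 0 < e \<and> (\<forall>g\<in>act ` B. e \<le> psum F (g x - g y))"
      if "x \<in> A" "y \<in> A" "x \<noteq> y" for x y
    proof -
      have "x \<in> Q" "y \<in> Q" using that \<open>A \<subseteq> Q\<close> by auto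
      from uniformly_distal[OF this \<open>x \<noteq> y\<close>] show ?thesis by (simp add: image_iff) metis
    qed
    have cont: "continuous_map (subtopology weak A) (subtopology weak A) g" if "g \<in> act ` B" for g
      using that cont unfolding T_def by blast
    have act_B: "countable (act ` B)" "act ` B \<noteq> {}" using B by auto
    obtain x where "x \<in> A" "\<forall>g\<in>act ` B. g x = x"
      by (rule countable_common_fixed_point[OF A(2,1,3) act_B])
        (rule cont comp nonexp distal that; assumption)+
    then have "x \<in> Fix s" if "s \<in> S" for s using that B(2) by (auto simp: Fix_def)
    then show ?thesis unfolding S(2) by blast
  qed
  ultimately have "\<Inter>(range Fix) \<noteq> {}"
    using T(1)[unfolded compact_space_fip, rule_format, of "range Fix"] by auto
  then show ?thesis using that by (auto simp: Fix_def)
qed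

section \<open>The nonexpansive retraction\<close>

text \<open>
  The semigroup of Bruck's method. The maps are extensional on \<open>Q\<close> so that they are points of the
  product space of pointwise weak convergence; they need not be weakly continuous.
\<close>

definition maps_fixing :: "('a \<Rightarrow> 'a) set" where
  "maps_fixing = {h \<in> (\<Pi>\<^sub>E x\<in>Q. Q). nonexpansive_map_on N Q h \<and> (\<forall>x\<in>fixed_points act Q. h x = x)}"

lemma act_compose_maps_fixing:
  assumes h: "h \<in> maps_fixing"
  shows "compose Q (act s) h \<in> maps_fixing"
proof -
  have hQ: "h x \<in> Q" if "x \<in> Q" for x using h that by (auto simp: maps_fixing_def)
  have "p (act s (h x) - act s (h y)) \<le> p (x - y)" if "p \<in> N" "x \<in> Q" "y \<in> Q" for p x y
  proof -
    have "p (act s (h x) - act s (h y)) \<le> p (h x - h y)"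
      using nonexp that hQ by (auto simp: nonexpansive_action_def nonexpansive_map_on_def)
    also have "\<dots> \<le> p (x - y)"
      using h that by (auto simp: maps_fixing_def nonexpansive_map_on_def)
    finally show ?thesis .
  qed
  then show ?thesis
    using h hQ act_maps by (auto simp: maps_fixing_def nonexpansive_map_on_def compose_def fixed_points_def)
qed

lemma compose_maps_fixing:
  assumes g: "g \<in> maps_fixing" and h: "h \<in> maps_fixing"
  shows "compose Q g h \<in> maps_fixing"
proof -
  have hQ: "h x \<in> Q" if "x \<in> Q" for x using h that by (auto simp: maps_fixing_def)
  have gQ: "g x \<in> Q" if "x \<in> Q" for x using g that by (auto simp: maps_fixing_def)
  have "p (g (h x) - g (h y)) \<le> p (x - y)" if "p \<in> N" "x \<in> Q" "y \<in> Q" for p x y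
  proof -
    have "p (g (h x) - g (h y)) \<le> p (h x - h y)"
      using g that hQ by (auto simp: maps_fixing_def nonexpansive_map_on_def)
    also have "\<dots> \<le> p (x - y)"
      using h that by (auto simp: maps_fixing_def nonexpansive_map_on_def)
    finally show ?thesis .
  qed
  then show ?thesis
    using g h hQ gQ by (auto simp: maps_fixing_def nonexpansive_map_on_def compose_def fixed_points_def)
qed

lemma convex_maps_fixing:
  assumes g: "g \<in> maps_fixing" and h: "h \<in> maps_fixing" and uv: "0 \<le> u" "0 \<le> v" "u + v = 1"
  shows "(\<lambda>x\<in>Q. u *\<^sub>R g x + v *\<^sub>R h x) \<in> maps_fixing"
proof -
  have "u *\<^sub>R g x + v *\<^sub>R h x \<in> Q" if "x \<in> Q" for x
    using g h that uv by (intro convexD[OF Q_convex]) (auto simp: maps_fixing_def)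
  moreover have "p (u *\<^sub>R g x + v *\<^sub>R h x - (u *\<^sub>R g y + v *\<^sub>R h y)) \<le> p (x - y)"
    if p: "p \<in> N" and x: "x \<in> Q" and y: "y \<in> Q" for p x y
  proof -
    note sp = seminorm_N[OF p]
    have eq: "u *\<^sub>R g x + v *\<^sub>R h x - (u *\<^sub>R g y + v *\<^sub>R h y) = u *\<^sub>R (g x - g y) + v *\<^sub>R (h x - h y)"
      by (simp add: algebra_simps)
    have "p (u *\<^sub>R g x + v *\<^sub>R h x - (u *\<^sub>R g y + v *\<^sub>R h y)) \<le> u * p (g x - g y) + v * p (h x - h y)"
      unfolding eq using seminorm_triangle[OF sp, of "u *\<^sub>R (g x - g y)" "v *\<^sub>R (h x - h y)"] uv
      by (simp add: seminorm_scaleR[OF sp])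
    also have "\<dots> \<le> u * p (x - y) + v * p (x - y)"
      using g h uv p x y by (intro add_mono mult_left_mono) (auto simp: maps_fixing_def nonexpansive_map_on_def)
    also have "\<dots> = p (x - y)" using uv by (simp add: distrib_right[symmetric])
    finally show ?thesis .
  qed
  moreover have "u *\<^sub>R x + v *\<^sub>R x = x" for x :: 'a
    using uv by (simp add: scaleR_left_distrib[symmetric])
  ultimately show ?thesis
    using g h by (auto simp: maps_fixing_def nonexpansive_map_on_def fixed_points_def)
qed

abbreviation self_maps :: "('a \<Rightarrow> 'a) topology" where
  "self_maps \<equiv> product_topology (\<lambda>_. subtopology weak Q) Q"

lemma eval_continuous: "x \<in> Q \<Longrightarrow> continuous_map self_maps weak (\<lambda>h. h x)"
  using continuous_map_product_projection[of x Q "\<lambda>_. subtopology weak Q"]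
  by (rule continuous_map_into_fulltopology)

lemma closedin_maps_fixing: "closedin self_maps maps_fixing"
proof -
  define I where "I = (\<lambda>(p, x, y). {h \<in> topspace self_maps. psum {p} (h x - h y) \<le> p (x - y)}) ` (N \<times> Q \<times> Q)"
  define J where "J = (\<lambda>(p, x). {h \<in> topspace self_maps. psum {p} (h x - x) \<le> 0}) ` (N \<times> fixed_points act Q)"
  have I: "closedin self_maps A" if "A \<in> I" for A
  proof -
    obtain p x y where "p \<in> N" "x \<in> Q" "y \<in> Q"
      and A: "A = {h \<in> topspace self_maps. psum {p} (h x - h y) \<le> p (x - y)}"
      using \<open>A \<in> I\<close> by (auto simp: I_def simp del: psum_singleton)
    then show ?thesis unfolding A using eval_continuous by (intro closedin_psum_le) auto
  qed
  have J: "closedin self_maps A" if "A \<in> J" for A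
  proof -
    obtain p x where "p \<in> N" "x \<in> Q"
      and A: "A = {h \<in> topspace self_maps. psum {p} (h x - x) \<le> 0}"
      using \<open>A \<in> J\<close> by (auto simp: J_def fixed_points_def simp del: psum_singleton)
    then show ?thesis unfolding A using eval_continuous by (intro closedin_psum_le) auto
  qed
  have "closedin self_maps (\<Inter>(insert (topspace self_maps) (I \<union> J)))"
    using I J closedin_topspace[of self_maps] by (intro closedin_Inter) blast+
  moreover have "h \<in> maps_fixing \<longleftrightarrow> h \<in> \<Inter>(insert (topspace self_maps) (I \<union> J))" for h
  proof (cases "h \<in> topspace self_maps")
    case True
    then have "(\<forall>A\<in>I. h \<in> A) \<longleftrightarrow> nonexpansive_map_on N Q h"
      "(\<forall>A\<in>J. h \<in> A) \<longleftrightarrow> (\<forall>x\<in>fixed_points act Q. h x = x)"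
      unfolding I_def J_def nonexpansive_map_on_def eq_iff_seminorms[of "h _"]
      by (auto simp: split_paired_Ball_Sigma)
    then show ?thesis using True by (simp add: maps_fixing_def ball_Un)
  qed (simp add: maps_fixing_def)
  then have "maps_fixing = \<Inter>(insert (topspace self_maps) (I \<union> J))" by blast
  ultimately show ?thesis by simp
qed

lemma nonexpansive_retract_fixed_points:
  "nonexpansive_retract N (fixed_points act Q) Q"
proof -
  have compact: "compact_space self_maps"
    using Q_compact by (simp add: compact_space_product_topology compact_space_subtopology)
  have Hausdorff: "Hausdorff_space self_maps"
    by (simp add: Hausdorff_space_product_topology Hausdorff_space_subtopology Hausdorff_weak)
  have PiE: "h \<in> (\<Pi>\<^sub>E x\<in>Q. Q)" if "h \<in> maps_fixing" for h using that by (simp add: maps_fixing_def)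
  have mem: "h x \<in> Q" if "h \<in> maps_fixing" "x \<in> Q" for h x using PiE that by auto
  have ne: "(\<lambda>x\<in>Q. x) \<in> maps_fixing"
    by (auto simp: maps_fixing_def nonexpansive_map_on_def fixed_points_def)
  have assoc: "compose Q (compose Q a b) c = compose Q a (compose Q b c)"
    if "a \<in> maps_fixing" "b \<in> maps_fixing" "c \<in> maps_fixing" for a b c
    using that mem by (auto simp: compose_def restrict_def fun_eq_iff)
  have cont: "continuous_map self_maps self_maps (\<lambda>a. compose Q a b)" if "b \<in> maps_fixing" for b
    using PiE[OF that] by (rule continuous_map_compose_left)
  have ne': "maps_fixing \<noteq> {}" using ne by blast
  obtain f where f: "f \<in> maps_fixing"
      "\<forall>h\<in>maps_fixing. \<exists>k\<in>maps_fixing. compose Q k (compose Q h f) = f"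
    by (rule right_topological_semigroup_minimal_element[OF compact Hausdorff closedin_maps_fixing ne'
          compose_maps_fixing assoc cont])
  have "f z \<in> fixed_points act Q" if z: "z \<in> Q" for z
  proof -
    define A where "A = (\<lambda>h. h (f z)) ` maps_fixing"
    have fz: "f z \<in> Q" using f(1) z by (rule mem)
    obtain w where w: "w \<in> A" "\<And>s. act s w = w"
    proof (rule common_fixed_point[of A])
      show "A \<subseteq> Q" using fz mem by (auto simp: A_def)
      show "A \<noteq> {}" using ne by (auto simp: A_def)
      have "compactin self_maps maps_fixing"
        using closedin_maps_fixing compact closedin_compact_space by blast
      then show "compactin weak A"
        unfolding A_def using eval_continuous[OF fz] by (rule image_compactin)
      show "convex A"
      proof (rule convexI)
        fix a b :: 'a and u v :: real
        assume ab: "a \<in> A" "b \<in> A" and uv: "0 \<le> u" "0 \<le> v" "u + v = 1"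
        obtain g h where gh: "g \<in> maps_fixing" "a = g (f z)" "h \<in> maps_fixing" "b = h (f z)"
          using ab by (auto simp: A_def)
        have "u *\<^sub>R a + v *\<^sub>R b = (\<lambda>x\<in>Q. u *\<^sub>R g x + v *\<^sub>R h x) (f z)" using gh fz by simp
        then show "u *\<^sub>R a + v *\<^sub>R b \<in> A"
          unfolding A_def using convex_maps_fixing[OF gh(1,3) uv] by blast
      qed
      show "act s ` A \<subseteq> A" for s
      proof
        fix a assume "a \<in> act s ` A"
        then obtain h where h: "h \<in> maps_fixing" "a = act s (h (f z))" by (auto simp: A_def)
        then have "a = compose Q (act s) h (f z)" using fz by (simp add: compose_eq)
        then show "a \<in> A" unfolding A_def using act_compose_maps_fixing[OF h(1)] by blast
      qed
    qed blast
    obtain h where h: "h \<in> maps_fixing" "w = h (f z)" using w(1) by (auto simp: A_def)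
    have wF: "w \<in> fixed_points act Q" using w(2) h fz mem by (auto simp: fixed_points_def)
    obtain k where k: "k \<in> maps_fixing" "compose Q k (compose Q h f) = f" using f(2) h(1) by blast
    \<comment> \<open>Since \<open>k\<close> fixes \<open>w = h (f z)\<close>, recovering \<open>f z\<close> through \<open>k\<close> returns \<open>w\<close> itself.\<close>
    have "f z = compose Q k (compose Q h f) z" using k(2) by simp
    also have "\<dots> = k w" using z h by (simp add: compose_eq)
    also have "\<dots> = w" using k(1) wF by (simp add: maps_fixing_def)
    finally show ?thesis using wF by simp
  qed
  moreover have "f x = x" if "x \<in> fixed_points act Q" for x using f(1) that by (simp add: maps_fixing_def)
  moreover have sub: "fixed_points act Q \<subseteq> Q" by (auto simp: fixed_points_def)
  ultimately have "f ` Q = fixed_points act Q" "\<forall>x\<in>Q. f (f x) = f x" by force+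
  moreover have "nonexpansive_map_on N Q f" using f(1) by (simp add: maps_fixing_def)
  ultimately show ?thesis unfolding nonexpansive_retract_def using sub by blast
qed

end

theorem theoremB:
  fixes \<tau> :: "'a::real_vector topology"
    and \<N> :: "('a \<Rightarrow> real) set"
    and Q :: "'a set"
    and act :: "'s::semigroup_mult \<Rightarrow> 'a \<Rightarrow> 'a"
  assumes "\<And>p. p \<in> \<N> \<Longrightarrow> seminorm p"
    and "\<tau> = seminorm_topology \<N>"
    and "Hausdorff_space \<tau>"
    and "Q \<noteq> {}"
    and "compactin (weak_topology \<tau>) Q"
    and "convex Q"
    and "dynamical_system act (subtopology (weak_topology \<tau>) Q)"
    and "nonexpansive_action \<N> act Q"
    and "distal_action \<tau> act Q"
  shows "(\<exists>x\<in>Q. \<forall>s. act s x = x) \<and> nonexpansive_retract \<N> (fixed_points act Q) Q"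
proof -
  interpret seminorm_family \<N> using assms(1) by unfold_locales
  interpret distal_nonexpansive_action \<N> act Q
    using assms Hausdorff_imp_separating by unfold_locales auto
  obtain x where "x \<in> Q" "\<And>s. act s x = x"
    using common_fixed_point[of Q] Q_nonempty Q_compact Q_convex act_maps by (metis image_subsetI order_refl)
  then show ?thesis using nonexpansive_retract_fixed_points by blast
qed

end
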